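(* The following unital $\ell$-groups are hopfian: (i) simple unital $\ell$-groups; (ii) finitely generated unital $\ell$-groups with only finitely many prime ideals; (iii) for every $n=1,2,\ldots$ and every rational point $w$ lying in the interior of the cube $[0,1]^n$, the germinal unital $\ell$-group $(G,u)$ at $w$, defined by $\Gamma(G,u)=\mathcal M([0,1]^n)/\mathfrak o_w$.
   Context: A unital $\ell$-group $(G,u)$ is an abelian group $G$ with a translation-invariant lattice order and a distinguished unit $u\geq 0$ such that every $0\le x\in G$ is dominated by some integer multiple of $u$. All unital $\ell$-groups are assumed nontrivial. Homomorphisms preserve the group structure, the lattice structure and the unit. An ideal of $(G,u)$ is the kernel of a homomorphism; ideals are assumed proper. An ideal $\mathfrak p$ is prime if $G/\mathfrak p$ is totally ordered. $(G,u)$ is simple if $\{0\}$ is its only proper ideal. An MV-algebra is an abelian monoid $(A,0,\oplus)$ with a unary operation $\neg$ satisfying $\neg\neg x=x$, $x\oplus\neg 0=\neg 0$ and $\neg(\neg x\oplus y)\oplus y=\neg(\neg y\oplus x)\oplus x$. $\Gamma(G,u)$ is the MV-algebra $([0,u],0,\neg,\oplus)$ with $\neg x=u-x$ and $x\oplus y=\min(u,x+y)$; with restriction of homomorphisms to the unit interval, $\Gamma$ is a categorical equivalence between unital $\ell$-groups and MV-algebras, so every MV-algebra is $\Gamma(G,u)$ for a unital $\ell$-group $(G,u)$ unique up to isomorphism. $\mathcal M([0,1]^n)$ is the MV-algebra (pointwise operations $\neg x=1-x$, $x\oplus y=\min(1,x+y)$) of all McNaughton functions on $[0,1]^n$: continuous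 functions $f\colon[0,1]^n\to[0,1]$ for which there are affine linear polynomials $p_1,\dots,p_u$ with integer coefficients such that for each $x$ there is $j$ with $f(x)=p_j(x)$. $\mathfrak o_w$ is the ideal of all $f\in\mathcal M([0,1]^n)$ that vanish identically over some open neighborhood of $w$. A point is rational if all its coordinates are rational. $(G,u)$ is hopfian if every homomorphism of $(G,u)$ onto $(G,u)$ is an automorphism. *)

theory Defs
  imports "HOL-Analysis.Analysis" "HOL-Algebra.Coset" "HOL-Algebra.Lattice"
begin

section \<open>Unital l-groups\<close>

text \<open>
  The abelian group is written multiplicatively, as in HOL-Algebra: the group operation
  is \<open>\<otimes>\<close>, its neutral element 0 is \<open>\<one>\<close>, and the integer multiple \<open>n u\<close> is \<open>u [^] n\<close>.
\<close>

record 'a ulgroup = "'a monoid" +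
  leq :: "'a \<Rightarrow> 'a \<Rightarrow> bool"  (infixl \<open>\<preceq>\<index>\<close> 50)
  order_unit :: 'a

definition lorder :: "'a ulgroup \<Rightarrow> 'a gorder" where
  "lorder G = \<lparr>carrier = carrier G, eq = (=), le = leq G\<rparr>"

abbreviation ljoin :: "'a ulgroup \<Rightarrow> 'a \<Rightarrow> 'a \<Rightarrow> 'a" where
  "ljoin G x y \<equiv> x \<squnion>\<^bsub>lorder G\<^esub> y"

abbreviation lmeet :: "'a ulgroup \<Rightarrow> 'a \<Rightarrow> 'a \<Rightarrow> 'a" where
  "lmeet G x y \<equiv> x \<sqinter>\<^bsub>lorder G\<^esub> y"

locale unital_lgroup = comm_group G for G :: "'a ulgroup" (structure) +
  assumes lattice_lorder: "Lattice.lattice (lorder G)"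
    and translation_invariant:
      "\<lbrakk>x \<in> carrier G; y \<in> carrier G; z \<in> carrier G; x \<preceq> y\<rbrakk> \<Longrightarrow> x \<otimes> z \<preceq> y \<otimes> z"
    and unit_closed: "order_unit G \<in> carrier G"
    and unit_nonneg: "\<one> \<preceq> order_unit G"
    and unit_dominates:
      "\<lbrakk>x \<in> carrier G; \<one> \<preceq> x\<rbrakk> \<Longrightarrow> \<exists>n::int. x \<preceq> order_unit G [^] n"
    and nontrivial: "carrier G \<noteq> {\<one>}"

definition ul_hom :: "'a ulgroup \<Rightarrow> 'b ulgroup \<Rightarrow> ('a \<Rightarrow> 'b) set" where
  "ul_hom G H = {h \<in> hom G H.
     (\<forall>x\<in>carrier G. \<forall>y\<in>carrier G.
        h (ljoin G x y) = ljoin H (h x) (h y) \<and> h (lmeet G x y) = lmeet H (h x) (h y)) \<and>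
     h (order_unit G) = order_unit H}"

definition ul_iso :: "'a ulgroup \<Rightarrow> 'b ulgroup \<Rightarrow> ('a \<Rightarrow> 'b) set" where
  "ul_iso G H = {h \<in> ul_hom G H. bij_betw h (carrier G) (carrier H)}"

definition hopfian :: "'a ulgroup \<Rightarrow> bool" where
  "hopfian G \<longleftrightarrow>
     (\<forall>h\<in>ul_hom G G. h ` carrier G = carrier G \<longrightarrow> h \<in> ul_iso G G)"

text \<open>
  Ideals are the kernels of homomorphisms into unital l-groups. As the codomain is nontrivial,
  they are proper. Codomains over the type of subsets of the carrier suffice, since every
  kernel arises from an image presented by cosets: see \<open>ul_ideal_kernel\<close> below.
\<close>

definition ul_ideal :: "'a ulgroup \<Rightarrow> 'a set \<Rightarrow> bool" where
  "ul_ideal G I \<longleftrightarrow>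
     (\<exists>(H :: 'a set ulgroup) h. unital_lgroup H \<and> h \<in> ul_hom G H \<and> I = kernel G H h)"

lemma lorder_simps [simp]:
  "carrier (lorder G) = carrier G" "le (lorder G) = leq G" "eq (lorder G) = (=)"
  by (simp_all add: lorder_def)

lemma lattice_lorderI:
  assumes refl: "\<And>x. x \<in> carrier G \<Longrightarrow> leq G x x"
    and antisym: "\<And>x y. \<lbrakk>x \<in> carrier G; y \<in> carrier G; leq G x y; leq G y x\<rbrakk> \<Longrightarrow> x = y"
    and trans: "\<And>x y z. \<lbrakk>x \<in> carrier G; y \<in> carrier G; z \<in> carrier G; leq G x y; leq G y z\<rbrakk>
      \<Longrightarrow> leq G x z"
    and sup: "\<And>x y. \<lbrakk>x \<in> carrier G; y \<in> carrier G\<rbrakk> \<Longrightarrow>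
      \<exists>s. least (lorder G) s (Upper (lorder G) {x, y})"
    and inf: "\<And>x y. \<lbrakk>x \<in> carrier G; y \<in> carrier G\<rbrakk> \<Longrightarrow>
      \<exists>s. greatest (lorder G) s (Lower (lorder G) {x, y})"
  shows "Lattice.lattice (lorder G)"
proof -
  interpret partial_order "lorder G"
    by unfold_locales (auto intro: refl antisym trans)
  show ?thesis
    by unfold_locales (auto intro: sup inf)
qed

context unital_lgroup
begin

lemma unit_neq_one: "order_unit G \<noteq> \<one>"
proof
  assume u: "order_unit G = \<one>"
  interpret L: Lattice.lattice "lorder G" by (rule lattice_lorder)
  have le1: "x \<preceq> \<one>" if x: "x \<in> carrier G" for x
  proof -
    let ?j = "ljoin G x \<one>"
    have j: "?j \<in> carrier G" using L.join_closed[of x \<one>] x by simp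
    have "\<one> \<preceq> ?j" "x \<preceq> ?j" using L.join_right[of x \<one>] L.join_left[of x \<one>] x by auto
    moreover from this unit_dominates[OF j] u have "?j \<preceq> \<one>" by auto
    ultimately show ?thesis using L.le_trans[of x ?j \<one>] x j by auto
  qed
  have "x = \<one>" if x: "x \<in> carrier G" for x
  proof -
    have "inv x \<otimes> x \<preceq> \<one> \<otimes> x"
      using translation_invariant[of "inv x" \<one> x] le1[of "inv x"] x by auto
    then have "\<one> \<preceq> x" using x by simp
    then show ?thesis using le1[OF x] L.le_antisym[of x \<one>] x by auto
  qed
  then show False using nontrivial by auto
qed

end

lemma ul_ideal_kernel:
  fixes G :: "'a ulgroup" and H :: "'b ulgroup"
  assumes G: "unital_lgroup G" and H: "unital_lgroup H" and h: "h \<in> ul_hom G H"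
  shows "ul_ideal G (kernel G H h)"
proof -
  interpret G: unital_lgroup G by (rule G)
  interpret H: unital_lgroup H by (rule H)
  interpret LG: Lattice.lattice "lorder G" by (rule G.lattice_lorder)
  interpret LH: Lattice.lattice "lorder H" by (rule H.lattice_lorder)
  have hom: "h \<in> hom G H" and
    hj: "\<And>x y. \<lbrakk>x \<in> carrier G; y \<in> carrier G\<rbrakk> \<Longrightarrow> h (ljoin G x y) = ljoin H (h x) (h y)" and
    hm: "\<And>x y. \<lbrakk>x \<in> carrier G; y \<in> carrier G\<rbrakk> \<Longrightarrow> h (lmeet G x y) = lmeet H (h x) (h y)" and
    hu: "h (order_unit G) = order_unit H"
    using h by (auto simp: ul_hom_def)
  interpret h: group_hom G H h by unfold_locales (rule hom)
  have jc: "ljoin G x y \<in> carrier G" and mc: "lmeet G x y \<in> carrier G"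
    if "x \<in> carrier G" "y \<in> carrier G" for x y
    using LG.join_closed LG.meet_closed that by auto
  define q where "q x = {z \<in> carrier G. h z = h x}" for x
  define r where "r X = (SOME z. z \<in> X)" for X :: "'a set"
  define K where "K = \<lparr>carrier = q ` carrier G, monoid.mult = (\<lambda>X Y. q (r X \<otimes>\<^bsub>G\<^esub> r Y)),
    one = q \<one>\<^bsub>G\<^esub>, leq = (\<lambda>X Y. h (r X) \<preceq>\<^bsub>H\<^esub> h (r Y)), order_unit = q (order_unit G)\<rparr>"
  have q_eq: "q x = q y \<longleftrightarrow> h x = h y" if "x \<in> carrier G" "y \<in> carrier G" for x y
    using that by (auto simp: q_def)
  have r: "r (q x) \<in> carrier G" "h (r (q x)) = h x" if "x \<in> carrier G" for x
  proof -
    have "x \<in> q x" using that by (simp add: q_def)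
    then have "r (q x) \<in> q x" unfolding r_def by (rule someI)
    then show "r (q x) \<in> carrier G" "h (r (q x)) = h x" by (auto simp: q_def)
  qed
  have K_carrier: "carrier K = q ` carrier G" and K_one: "\<one>\<^bsub>K\<^esub> = q \<one>\<^bsub>G\<^esub>"
    and K_unit: "order_unit K = q (order_unit G)" by (auto simp: K_def)
  have K_mult: "q x \<otimes>\<^bsub>K\<^esub> q y = q (x \<otimes>\<^bsub>G\<^esub> y)" if "x \<in> carrier G" "y \<in> carrier G" for x y
    using that r by (simp add: K_def q_eq)
  have K_leq: "q x \<preceq>\<^bsub>K\<^esub> q y \<longleftrightarrow> h x \<preceq>\<^bsub>H\<^esub> h y" if "x \<in> carrier G" "y \<in> carrier G" for x y
    using that r by (simp add: K_def)
  have K_group: "comm_group K"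
  proof (rule comm_groupI)
    fix X assume "X \<in> carrier K"
    then obtain x where x: "x \<in> carrier G" "X = q x" by (auto simp: K_carrier)
    then show "\<exists>Y\<in>carrier K. Y \<otimes>\<^bsub>K\<^esub> X = \<one>\<^bsub>K\<^esub>"
      by (intro bexI[of _ "q (inv\<^bsub>G\<^esub> x)"]) (auto simp: K_carrier K_one K_mult)
  qed (auto simp: K_carrier K_one K_mult G.m_ac)
  have lst: "least (lorder K) (q (ljoin G x y)) (Upper (lorder K) {q x, q y})"
    if x: "x \<in> carrier G" "y \<in> carrier G" for x y
  proof (rule least_UpperI)
    fix Z assume "Z \<in> {q x, q y}"
    then show "Z \<sqsubseteq>\<^bsub>lorder K\<^esub> q (ljoin G x y)"
      using x jc LH.join_left[of "h x" "h y"] LH.join_right[of "h x" "h y"]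
      by (auto simp: K_leq hj)
  next
    fix Z assume Z: "Z \<in> Upper (lorder K) {q x, q y}"
    then obtain z where z: "z \<in> carrier G" "Z = q z" by (auto simp: Upper_def K_carrier)
    with Z x have "h x \<preceq>\<^bsub>H\<^esub> h z" "h y \<preceq>\<^bsub>H\<^esub> h z"
      by (auto simp: Upper_def K_carrier K_leq)
    then show "q (ljoin G x y) \<sqsubseteq>\<^bsub>lorder K\<^esub> Z"
      using LH.join_le[of "h x" "h z" "h y"] x z jc by (auto simp: K_leq hj)
  qed (use x jc in \<open>auto simp: K_carrier\<close>)
  have gst: "greatest (lorder K) (q (lmeet G x y)) (Lower (lorder K) {q x, q y})"
    if x: "x \<in> carrier G" "y \<in> carrier G" for x y
  proof (rule greatest_LowerI)
    fix Z assume "Z \<in> {q x, q y}"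
    then show "q (lmeet G x y) \<sqsubseteq>\<^bsub>lorder K\<^esub> Z"
      using x mc LH.meet_left[of "h x" "h y"] LH.meet_right[of "h x" "h y"]
      by (auto simp: K_leq hm)
  next
    fix Z assume Z: "Z \<in> Lower (lorder K) {q x, q y}"
    then obtain z where z: "z \<in> carrier G" "Z = q z" by (auto simp: Lower_def K_carrier)
    with Z x have "h z \<preceq>\<^bsub>H\<^esub> h x" "h z \<preceq>\<^bsub>H\<^esub> h y"
      by (auto simp: Lower_def K_carrier K_leq)
    then show "Z \<sqsubseteq>\<^bsub>lorder K\<^esub> q (lmeet G x y)"
      using LH.meet_le[of "h z" "h x" "h y"] x z mc by (auto simp: K_leq hm)
  qed (use x mc in \<open>auto simp: K_carrier\<close>)
  have K_lattice: "Lattice.lattice (lorder K)"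
  proof (rule lattice_lorderI)
    fix X assume "X \<in> carrier K" then show "X \<preceq>\<^bsub>K\<^esub> X"
      using LH.le_refl by (auto simp: K_carrier K_leq)
  next
    fix X Y assume "X \<in> carrier K" "Y \<in> carrier K" "X \<preceq>\<^bsub>K\<^esub> Y" "Y \<preceq>\<^bsub>K\<^esub> X"
    then obtain x y where "x \<in> carrier G" "X = q x" "y \<in> carrier G" "Y = q y"
      "h x \<preceq>\<^bsub>H\<^esub> h y" "h y \<preceq>\<^bsub>H\<^esub> h x"
      by (auto simp: K_carrier K_leq)
    then show "X = Y" using LH.le_antisym[of "h x" "h y"] by (simp add: q_eq)
  next
    fix X Y Z assume "X \<in> carrier K" "Y \<in> carrier K" "Z \<in> carrier K" "X \<preceq>\<^bsub>K\<^esub> Y" "Y \<preceq>\<^bsub>K\<^esub> Z"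
    then show "X \<preceq>\<^bsub>K\<^esub> Z"
      by (auto simp: K_carrier K_leq) (metis LH.le_trans lorder_simps(1,2) h.hom_closed)
  next
    fix X Y assume "X \<in> carrier K" "Y \<in> carrier K"
    then show "\<exists>s. least (lorder K) s (Upper (lorder K) {X, Y})"
      "\<exists>s. greatest (lorder K) s (Lower (lorder K) {X, Y})"
      using lst gst unfolding K_carrier by blast+
  qed
  interpret KL: Lattice.lattice "lorder K" by (rule K_lattice)
  interpret K: comm_group K by (rule K_group)
  have qhom: "q \<in> hom G K" by (auto simp: hom_def K_carrier K_mult)
  have K_pow: "q x [^]\<^bsub>K\<^esub> (n::int) = q (x [^]\<^bsub>G\<^esub> n)" if "x \<in> carrier G" for x n
    using hom_int_pow[OF qhom that] G.is_group K.is_group by simp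
  have "unital_lgroup K"
  proof (intro unital_lgroup.intro[OF K_group] unital_lgroup_axioms.intro K_lattice)
    fix X Y Z assume "X \<in> carrier K" "Y \<in> carrier K" "Z \<in> carrier K" "X \<preceq>\<^bsub>K\<^esub> Y"
    then show "X \<otimes>\<^bsub>K\<^esub> Z \<preceq>\<^bsub>K\<^esub> Y \<otimes>\<^bsub>K\<^esub> Z"
      using H.translation_invariant by (auto simp: K_carrier K_mult K_leq)
  next
    fix X assume "X \<in> carrier K" "\<one>\<^bsub>K\<^esub> \<preceq>\<^bsub>K\<^esub> X"
    then obtain x where x: "x \<in> carrier G" "X = q x" "\<one>\<^bsub>H\<^esub> \<preceq>\<^bsub>H\<^esub> h x"
      by (auto simp: K_carrier K_one K_leq)
    then obtain n :: int where "h x \<preceq>\<^bsub>H\<^esub> order_unit H [^]\<^bsub>H\<^esub> n"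
      using H.unit_dominates[OF h.hom_closed] by blast
    then show "\<exists>n::int. X \<preceq>\<^bsub>K\<^esub> order_unit K [^]\<^bsub>K\<^esub> n"
      using x G.unit_closed h.hom_int_pow[of "order_unit G" n]
      by (auto simp: K_unit K_pow K_leq hu intro!: exI[of _ n])
  next
    have "order_unit K \<noteq> \<one>\<^bsub>K\<^esub>" "order_unit K \<in> carrier K"
      using H.unit_neq_one G.unit_closed by (auto simp: K_unit K_one q_eq hu K_carrier)
    then show "carrier K \<noteq> {\<one>\<^bsub>K\<^esub>}" by auto
  qed (use G.unit_closed H.unit_nonneg in \<open>auto simp: K_carrier K_unit K_one K_leq hu\<close>)
  moreover have "q \<in> ul_hom G K"
  proof -
    have "q (ljoin G x y) = ljoin K (q x) (q y)" if "x \<in> carrier G" "y \<in> carrier G" for x y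
      by (rule KL.joinI[of "q x" "q y" "\<lambda>l. q (ljoin G x y) = l"])
        (use lst[OF that] KL.least_unique that in \<open>auto simp: K_carrier\<close>)
    moreover have "q (lmeet G x y) = lmeet K (q x) (q y)"
      if "x \<in> carrier G" "y \<in> carrier G" for x y
      by (rule KL.meetI[of "q x" "q y" "\<lambda>l. q (lmeet G x y) = l"])
        (use gst[OF that] KL.greatest_unique that in \<open>auto simp: K_carrier\<close>)
    ultimately show ?thesis using qhom by (auto simp: ul_hom_def K_unit)
  qed
  moreover have "kernel G H h = kernel G K q"
    using q_eq[OF _ G.one_closed] by (auto simp: kernel_def K_one)
  ultimately show ?thesis unfolding ul_ideal_def by blast
qed

definition ul_quotient :: "'a ulgroup \<Rightarrow> 'a set \<Rightarrow> 'a set ulgroup" where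
  "ul_quotient G I =
     \<lparr>carrier = carrier (G Mod I), monoid.mult = monoid.mult (G Mod I), one = \<one>\<^bsub>G Mod I\<^esub>,
      leq = (\<lambda>X Y. \<exists>x\<in>X. \<exists>y\<in>Y. x \<preceq>\<^bsub>G\<^esub> y),
      order_unit = I #>\<^bsub>G\<^esub> order_unit G\<rparr>"

definition ul_prime_ideal :: "'a ulgroup \<Rightarrow> 'a set \<Rightarrow> bool" where
  "ul_prime_ideal G I \<longleftrightarrow> ul_ideal G I \<and> Order.total_order (lorder (ul_quotient G I))"

definition ul_simple :: "'a ulgroup \<Rightarrow> bool" where
  "ul_simple G \<longleftrightarrow> {I. ul_ideal G I} = {{\<one>\<^bsub>G\<^esub>}}"

inductive_set ul_generate :: "'a ulgroup \<Rightarrow> 'a set \<Rightarrow> 'a set" for G and S where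
  one: "\<one>\<^bsub>G\<^esub> \<in> ul_generate G S"
| unit: "order_unit G \<in> ul_generate G S"
| incl: "x \<in> S \<Longrightarrow> x \<in> ul_generate G S"
| inv: "x \<in> ul_generate G S \<Longrightarrow> inv\<^bsub>G\<^esub> x \<in> ul_generate G S"
| mult: "\<lbrakk>x \<in> ul_generate G S; y \<in> ul_generate G S\<rbrakk> \<Longrightarrow> x \<otimes>\<^bsub>G\<^esub> y \<in> ul_generate G S"
| join: "\<lbrakk>x \<in> ul_generate G S; y \<in> ul_generate G S\<rbrakk> \<Longrightarrow> ljoin G x y \<in> ul_generate G S"
| meet: "\<lbrakk>x \<in> ul_generate G S; y \<in> ul_generate G S\<rbrakk> \<Longrightarrow> lmeet G x y \<in> ul_generate G S"

definition ul_finitely_generated :: "'a ulgroup \<Rightarrow> bool" where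
  "ul_finitely_generated G \<longleftrightarrow>
     (\<exists>S. finite S \<and> S \<subseteq> carrier G \<and> ul_generate G S = carrier G)"


section \<open>MV-algebras\<close>

record 'a mv = "'a partial_object" +
  mv_zero :: 'a
  mv_plus :: "'a \<Rightarrow> 'a \<Rightarrow> 'a"
  mv_neg :: "'a \<Rightarrow> 'a"

locale mv_algebra =
  fixes A :: "'a mv"
  assumes zero_closed: "mv_zero A \<in> carrier A"
    and plus_closed: "\<lbrakk>x \<in> carrier A; y \<in> carrier A\<rbrakk> \<Longrightarrow> mv_plus A x y \<in> carrier A"
    and neg_closed: "x \<in> carrier A \<Longrightarrow> mv_neg A x \<in> carrier A"
    and plus_assoc: "\<lbrakk>x \<in> carrier A; y \<in> carrier A; z \<in> carrier A\<rbrakk> \<Longrightarrow>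
      mv_plus A (mv_plus A x y) z = mv_plus A x (mv_plus A y z)"
    and plus_commute: "\<lbrakk>x \<in> carrier A; y \<in> carrier A\<rbrakk> \<Longrightarrow> mv_plus A x y = mv_plus A y x"
    and plus_zero: "x \<in> carrier A \<Longrightarrow> mv_plus A x (mv_zero A) = x"
    and neg_neg: "x \<in> carrier A \<Longrightarrow> mv_neg A (mv_neg A x) = x"
    and plus_neg_zero: "x \<in> carrier A \<Longrightarrow>
      mv_plus A x (mv_neg A (mv_zero A)) = mv_neg A (mv_zero A)"
    and lukasiewicz: "\<lbrakk>x \<in> carrier A; y \<in> carrier A\<rbrakk> \<Longrightarrow>
      mv_plus A (mv_neg A (mv_plus A (mv_neg A x) y)) y =
      mv_plus A (mv_neg A (mv_plus A (mv_neg A y) x)) x"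

definition mv_iso :: "'a mv \<Rightarrow> 'b mv \<Rightarrow> ('a \<Rightarrow> 'b) set" where
  "mv_iso A B = {h. bij_betw h (carrier A) (carrier B) \<and>
     h (mv_zero A) = mv_zero B \<and>
     (\<forall>x\<in>carrier A. h (mv_neg A x) = mv_neg B (h x)) \<and>
     (\<forall>x\<in>carrier A. \<forall>y\<in>carrier A. h (mv_plus A x y) = mv_plus B (h x) (h y))}"

definition Gamma :: "'a ulgroup \<Rightarrow> 'a mv" where
  "Gamma G =
     \<lparr>carrier = {x \<in> carrier G. \<one>\<^bsub>G\<^esub> \<preceq>\<^bsub>G\<^esub> x \<and> x \<preceq>\<^bsub>G\<^esub> order_unit G},
      mv_zero = \<one>\<^bsub>G\<^esub>,
      mv_plus = (\<lambda>x y. lmeet G (order_unit G) (x \<otimes>\<^bsub>G\<^esub> y)),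
      mv_neg = (\<lambda>x. order_unit G \<otimes>\<^bsub>G\<^esub> inv\<^bsub>G\<^esub> x)\<rparr>"

definition mv_minus :: "'a mv \<Rightarrow> 'a \<Rightarrow> 'a \<Rightarrow> 'a" where
  "mv_minus A x y = mv_neg A (mv_plus A (mv_neg A x) y)"

text \<open>
  The congruence associated with an ideal \<open>I\<close> relates \<open>x\<close> and \<open>y\<close> when their (Chang) distance,
  the sum of the two truncated differences, lies in \<open>I\<close>.
\<close>

definition mv_class :: "'a mv \<Rightarrow> 'a set \<Rightarrow> 'a \<Rightarrow> 'a set" where
  "mv_class A I x = {y \<in> carrier A. mv_plus A (mv_minus A x y) (mv_minus A y x) \<in> I}"

definition mv_quotient :: "'a mv \<Rightarrow> 'a set \<Rightarrow> 'a set mv" where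
  "mv_quotient A I =
     \<lparr>carrier = mv_class A I ` carrier A,
      mv_zero = mv_class A I (mv_zero A),
      mv_plus = (\<lambda>X Y. \<Union>x\<in>X. \<Union>y\<in>Y. mv_class A I (mv_plus A x y)),
      mv_neg = (\<lambda>X. \<Union>x\<in>X. mv_class A I (mv_neg A x))\<rparr>"


section \<open>McNaughton functions and germs\<close>

definition cube :: "(real^'n) set" where
  "cube = {x. \<forall>i. 0 \<le> x $ i \<and> x $ i \<le> 1}"

definition int_affine :: "(real^'n \<Rightarrow> real) \<Rightarrow> bool" where
  "int_affine p \<longleftrightarrow>
     (\<exists>(a :: int^'n) (b :: int). \<forall>x. p x = (\<Sum>i\<in>UNIV. of_int (a $ i) * x $ i) + of_int b)"

text \<open>
  A function on the cube is represented by its unique extension that is \<open>undefined\<close> off the cube,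
  so that HOL equality of representatives is equality of functions on the cube.
\<close>

definition mcnaughton_function :: "(real^'n \<Rightarrow> real) \<Rightarrow> bool" where
  "mcnaughton_function f \<longleftrightarrow>
     f \<in> extensional cube \<and> f ` cube \<subseteq> {0..1} \<and> continuous_on cube f \<and>
     (\<exists>P. finite P \<and> (\<forall>p\<in>P. int_affine p) \<and> (\<forall>x\<in>cube. \<exists>p\<in>P. f x = p x))"

definition McNaughton :: "(real^'n \<Rightarrow> real) mv" where
  "McNaughton =
     \<lparr>carrier = {f. mcnaughton_function f},
      mv_zero = restrict (\<lambda>x. 0) cube,
      mv_plus = (\<lambda>f g. restrict (\<lambda>x. min 1 (f x + g x)) cube),
      mv_neg = (\<lambda>f. restrict (\<lambda>x. 1 - f x) cube)\<rparr>"

lemma mv_algebra_McNaughton: "mv_algebra (McNaughton :: (real^'n \<Rightarrow> real) mv)"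
proof -
  have const: "int_affine (\<lambda>x :: real^'n. of_int c)" for c
    unfolding int_affine_def by (intro exI[of _ 0] exI[of _ c]) simp
  have add: "int_affine (\<lambda>x. p x + q x)"
    if pq: "int_affine p" "int_affine q" for p q :: "real^'n \<Rightarrow> real"
  proof -
    obtain a b a' b' where "\<forall>x. p x = (\<Sum>i\<in>UNIV. of_int (a $ i) * x $ i) + of_int b"
      "\<forall>x. q x = (\<Sum>i\<in>UNIV. of_int (a' $ i) * x $ i) + of_int b'"
      using pq unfolding int_affine_def by blast
    then show ?thesis unfolding int_affine_def
      by (intro exI[of _ "a + a'"] exI[of _ "b + b'"]) (simp add: algebra_simps sum.distrib)
  qed
  have neg: "int_affine (\<lambda>x. - p x)" if pq: "int_affine p" for p :: "real^'n \<Rightarrow> real"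
  proof -
    obtain a b where "\<forall>x. p x = (\<Sum>i\<in>UNIV. of_int (a $ i) * x $ i) + of_int b"
      using pq unfolding int_affine_def by blast
    then show ?thesis unfolding int_affine_def
      by (intro exI[of _ "- a"] exI[of _ "- b"]) (simp add: sum_negf)
  qed
  have zero: "mcnaughton_function (restrict (\<lambda>x :: real^'n. 0) cube)"
    unfolding mcnaughton_function_def using const[of 0]
    by (auto intro!: exI[of _ "{\<lambda>x. 0}"])
  have neg_mc: "mcnaughton_function (restrict (\<lambda>x. 1 - f x) cube)"
    if f: "mcnaughton_function f" for f :: "real^'n \<Rightarrow> real"
  proof -
    obtain P where P: "finite P" "\<forall>p\<in>P. int_affine p" "\<forall>x\<in>cube. \<exists>p\<in>P. f x = p x"
      using f by (auto simp: mcnaughton_function_def)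
    have "int_affine (\<lambda>x. 1 - p x)" if "p \<in> P" for p
      using add[OF const[of 1] neg[of p]] P that by simp
    then show ?thesis
      using f P unfolding mcnaughton_function_def
      by (auto intro!: continuous_intros exI[of _ "(\<lambda>p x. 1 - p x) ` P"] simp: image_subset_iff
          cong: continuous_on_cong)
  qed
  have add_mc: "mcnaughton_function (restrict (\<lambda>x. min 1 (f x + g x)) cube)"
    if f: "mcnaughton_function f" and g: "mcnaughton_function g" for f g :: "real^'n \<Rightarrow> real"
  proof -
    obtain P where P: "finite P" "\<forall>p\<in>P. int_affine p" "\<forall>x\<in>cube. \<exists>p\<in>P. f x = p x"
      using f by (auto simp: mcnaughton_function_def)
    obtain Q where Q: "finite Q" "\<forall>p\<in>Q. int_affine p" "\<forall>x\<in>cube. \<exists>p\<in>Q. g x = p x"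
      using g by (auto simp: mcnaughton_function_def)
    define R where "R = insert (\<lambda>x :: real^'n. 1) ((\<lambda>(p, q) x. p x + q x) ` (P \<times> Q))"
    have "finite R" "\<forall>p\<in>R. int_affine p"
      using P Q add const[of 1] by (auto simp: R_def)
    moreover have "\<exists>p\<in>R. min 1 (f x + g x) = p x" if "x \<in> cube" for x
    proof -
      obtain p q where "p \<in> P" "f x = p x" "q \<in> Q" "g x = q x" using P Q \<open>x \<in> cube\<close> by meson
      then show ?thesis by (cases "f x + g x \<le> 1") (force simp: R_def)+
    qed
    ultimately show ?thesis
      using f g unfolding mcnaughton_function_def
      by (auto intro!: continuous_intros exI[of _ R] simp: image_subset_iff
          cong: continuous_on_cong)
  qed
  have eq: "f = g" if "mcnaughton_function f" "mcnaughton_function g" "\<And>x. x \<in> cube \<Longrightarrow> f x = g x"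
    for f g :: "real^'n \<Rightarrow> real"
    using that extensionalityI[of f cube g] by (auto simp: mcnaughton_function_def)
  have ge0: "0 \<le> f x" and le1: "f x \<le> 1" if "mcnaughton_function f" "x \<in> cube"
    for f and x :: "real^'n"
    using that by (auto simp: mcnaughton_function_def image_subset_iff)
  note mc = zero neg_mc add_mc zero[unfolded restrict_def] neg_mc[unfolded restrict_def]
    add_mc[unfolded restrict_def]
  have assoc: "min 1 (c + min 1 (a + b)) = min 1 (a + min 1 (b + c))"
    if "0 \<le> a" "0 \<le> b" "0 \<le> c" for a b c :: real
    using that by (auto simp: min_def)
  have luk: "min 1 (1 - min 1 (1 - a + b) + b) = min 1 (1 - min 1 (1 - b + a) + a)"
    for a b :: real
    by (auto simp: min_def)
  show ?thesis
    by unfold_locales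
      (auto simp: McNaughton_def add.commute ge0 le1 intro!: eq mc assoc luk[simplified add.commute])
qed

definition germ_ideal :: "real^'n \<Rightarrow> (real^'n \<Rightarrow> real) set" where
  "germ_ideal w =
     {f \<in> carrier McNaughton. \<exists>U. open U \<and> w \<in> U \<and> (\<forall>x\<in>U \<inter> cube. f x = 0)}"

definition rational_point :: "real^'n \<Rightarrow> bool" where
  "rational_point w \<longleftrightarrow> (\<forall>i. w $ i \<in> \<rat>)"

text \<open>The germinal unital l-group at \<open>w\<close> is determined only up to isomorphism.\<close>

definition germinal_ulgroup :: "'a ulgroup \<Rightarrow> real^'n \<Rightarrow> bool" where
  "germinal_ulgroup G w \<longleftrightarrow>
     unital_lgroup G \<and> mv_iso (Gamma G) (mv_quotient McNaughton (germ_ideal w)) \<noteq> {}"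

end

theory Submission
  imports Defs
begin

text \<open>
  A surjective endomorphism \<open>h\<close> of a unital l-group is an automorphism as soon as its kernel is
  trivial. The kernel is a proper ideal, which settles the simple case. Pulling prime ideals back
  along \<open>h\<close> is injective, hence bijective if there are only finitely many of them; so the kernel
  lies in every prime ideal, and prime ideals separate points (Zorn).

  In the germinal case it suffices to look at the unit interval, whose elements are germs at \<open>w\<close>
  of McNaughton functions. As McNaughton functions are generated by the coordinates, \<open>h\<close> is given
  by composition with a continuous self-map \<open>g\<close> of the cube whose components are McNaughton
  functions. McNaughton functions vanishing near \<open>w\<close> separate \<open>w\<close> from all other points, so
  \<open>g\<close> fixes \<open>w\<close>. Surjectivity of \<open>h\<close> gives a left inverse of \<open>g\<close> near \<open>w\<close>, so by
  invariance of domain \<open>g\<close> maps neighbourhoods of \<open>w\<close> onto neighbourhoods of \<open>w\<close>, and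
  \<open>f \<circ> g\<close> vanishes near \<open>w\<close> only if \<open>f\<close> does.
\<close>

section \<open>Unital l-groups and their homomorphisms\<close>

context unital_lgroup
begin

interpretation L: Lattice.lattice "lorder G"
  by (rule lattice_lorder)

section \<open>Order arithmetic in a unital l-group\<close>

lemma le_refl: "x \<in> carrier G \<Longrightarrow> x \<preceq> x"
  using L.le_refl by simp

lemma le_trans:
  "\<lbrakk>x \<preceq> y; y \<preceq> z; x \<in> carrier G; y \<in> carrier G; z \<in> carrier G\<rbrakk> \<Longrightarrow> x \<preceq> z"
  using L.le_trans[of x y z] by simp

lemma le_antisym:
  "\<lbrakk>x \<preceq> y; y \<preceq> x; x \<in> carrier G; y \<in> carrier G\<rbrakk> \<Longrightarrow> x = y"
  using L.le_antisym[of x y] by simp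

lemma ljoin_closed: "\<lbrakk>x \<in> carrier G; y \<in> carrier G\<rbrakk> \<Longrightarrow> ljoin G x y \<in> carrier G"
  using L.join_closed[of x y] by simp

lemma lmeet_closed: "\<lbrakk>x \<in> carrier G; y \<in> carrier G\<rbrakk> \<Longrightarrow> lmeet G x y \<in> carrier G"
  using L.meet_closed[of x y] by simp

lemma ljoin_left: "\<lbrakk>x \<in> carrier G; y \<in> carrier G\<rbrakk> \<Longrightarrow> x \<preceq> ljoin G x y"
  using L.join_left[of x y] by simp

lemma ljoin_right: "\<lbrakk>x \<in> carrier G; y \<in> carrier G\<rbrakk> \<Longrightarrow> y \<preceq> ljoin G x y"
  using L.join_right[of x y] by simp

lemma ljoin_least:
  "\<lbrakk>x \<preceq> z; y \<preceq> z; x \<in> carrier G; y \<in> carrier G; z \<in> carrier G\<rbrakk> \<Longrightarrow> ljoin G x y \<preceq> z"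
  using L.join_le[of x z y] by simp

lemma lmeet_left: "\<lbrakk>x \<in> carrier G; y \<in> carrier G\<rbrakk> \<Longrightarrow> lmeet G x y \<preceq> x"
  using L.meet_left[of x y] by simp

lemma lmeet_right: "\<lbrakk>x \<in> carrier G; y \<in> carrier G\<rbrakk> \<Longrightarrow> lmeet G x y \<preceq> y"
  using L.meet_right[of x y] by simp

lemma lmeet_greatest:
  "\<lbrakk>z \<preceq> x; z \<preceq> y; x \<in> carrier G; y \<in> carrier G; z \<in> carrier G\<rbrakk> \<Longrightarrow> z \<preceq> lmeet G x y"
  using L.meet_le[of z x y] by simp

lemma ljoin_absorb:
  "\<lbrakk>x \<preceq> y; x \<in> carrier G; y \<in> carrier G\<rbrakk> \<Longrightarrow> ljoin G x y = y"
  by (intro le_antisym ljoin_least ljoin_right ljoin_closed le_refl)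

lemma lmeet_absorb1:
  "\<lbrakk>x \<preceq> y; x \<in> carrier G; y \<in> carrier G\<rbrakk> \<Longrightarrow> lmeet G x y = x"
  by (intro le_antisym lmeet_greatest lmeet_left lmeet_closed le_refl)

lemma mult_le_mono:
  assumes "x \<preceq> y" "z \<preceq> t" "x \<in> carrier G" "y \<in> carrier G" "z \<in> carrier G" "t \<in> carrier G"
  shows "x \<otimes> z \<preceq> y \<otimes> t"
proof -
  have "x \<otimes> z \<preceq> y \<otimes> z" using assms by (intro translation_invariant)
  moreover have "y \<otimes> z \<preceq> y \<otimes> t"
    using translation_invariant[of z t y] assms by (simp add: m_comm)
  ultimately show ?thesis using assms by (auto intro: le_trans)
qed

lemma le_mult_iff:
  assumes "x \<in> carrier G" "y \<in> carrier G" "z \<in> carrier G"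
  shows "x \<preceq> y \<otimes> z \<longleftrightarrow> x \<otimes> inv z \<preceq> y"
proof
  assume "x \<preceq> y \<otimes> z"
  then show "x \<otimes> inv z \<preceq> y"
    using translation_invariant[of x "y \<otimes> z" "inv z"] assms by (simp add: m_assoc)
next
  assume "x \<otimes> inv z \<preceq> y"
  then show "x \<preceq> y \<otimes> z"
    using translation_invariant[of "x \<otimes> inv z" y z] assms by (simp add: m_assoc)
qed

lemma inv_le_iff:
  assumes "x \<in> carrier G" "y \<in> carrier G"
  shows "inv x \<preceq> inv y \<longleftrightarrow> y \<preceq> x"
proof
  have mono: "inv b \<preceq> inv a" if "a \<preceq> b" "a \<in> carrier G" "b \<in> carrier G" for a b
    using translation_invariant[of a b "inv a \<otimes> inv b"] that
    by (simp add: m_assoc[symmetric]) (simp add: m_comm[of b "inv a"] m_assoc)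
  show "inv x \<preceq> inv y" if "y \<preceq> x"
    using mono that assms by blast
  show "y \<preceq> x" if "inv x \<preceq> inv y"
    using mono[OF that] assms by simp
qed

lemma one_le_mult:
  "\<lbrakk>\<one> \<preceq> x; \<one> \<preceq> y; x \<in> carrier G; y \<in> carrier G\<rbrakk> \<Longrightarrow> \<one> \<preceq> x \<otimes> y"
  using mult_le_mono[of \<one> x \<one> y] by simp

lemma le_mult_right:
  "\<lbrakk>\<one> \<preceq> y; x \<in> carrier G; y \<in> carrier G\<rbrakk> \<Longrightarrow> x \<preceq> x \<otimes> y"
  using mult_le_mono[of x x \<one> y] le_refl by simp

lemma le_mult_left:
  "\<lbrakk>\<one> \<preceq> y; x \<in> carrier G; y \<in> carrier G\<rbrakk> \<Longrightarrow> x \<preceq> y \<otimes> x"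
  using le_mult_right[of y x] m_comm[of x y] by simp

lemma one_le_pow: "\<lbrakk>\<one> \<preceq> x; x \<in> carrier G\<rbrakk> \<Longrightarrow> \<one> \<preceq> x [^] (n::nat)"
  by (induction n) (auto intro: le_refl one_le_mult)

section \<open>Disjoint elements and the order unit\<close>

text \<open>For \<open>a\<close> and \<open>b\<close> in the positive cone this is orthogonality:
  their meet is neutral. Phrasing it by lower bounds avoids computing with meets and also makes
  sense for elements that are not positive.\<close>

definition ldisjoint :: "'a \<Rightarrow> 'a \<Rightarrow> bool" where
  "ldisjoint a b \<longleftrightarrow> (\<forall>t\<in>carrier G. t \<preceq> a \<and> t \<preceq> b \<longrightarrow> t \<preceq> \<one>)"

lemma ldisjoint_commute: "ldisjoint a b \<longleftrightarrow> ldisjoint b a"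
  by (auto simp: ldisjoint_def)

text \<open>Since \<open>c\<close> is positive, dividing a common lower bound \<open>t\<close> by
  \<open>c\<close> keeps it below \<open>a\<close> and puts it below \<open>b\<close>. Disjointness
  from \<open>b\<close> then yields \<open>t \<preceq> c\<close>, and disjointness from
  \<open>c\<close> finishes.\<close>

lemma ldisjoint_mult:
  assumes "ldisjoint a b" "ldisjoint a c" "\<one> \<preceq> c"
    and [simp]: "a \<in> carrier G" "b \<in> carrier G" "c \<in> carrier G"
  shows "ldisjoint a (b \<otimes> c)"
  unfolding ldisjoint_def
proof safe
  fix t assume [simp]: "t \<in> carrier G" and t: "t \<preceq> a" "t \<preceq> b \<otimes> c"
  have "t \<otimes> inv c \<preceq> b" using t by (simp add: le_mult_iff)
  moreover have "t \<otimes> inv c \<preceq> t"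
    using le_mult_right[of c t] assms(3) le_mult_iff[of t t c] by simp
  ultimately have "t \<otimes> inv c \<preceq> \<one>"
    using assms(1) t le_trans[of "t \<otimes> inv c" t a] by (simp add: ldisjoint_def)
  then have "t \<preceq> c" using le_mult_iff[of t \<one> c] by simp
  then show "t \<preceq> \<one>" using assms(2) t by (auto simp: ldisjoint_def)
qed

lemma ldisjoint_pow:
  fixes n :: nat
  assumes "ldisjoint a b" "\<one> \<preceq> b" "a \<in> carrier G" "b \<in> carrier G"
  shows "ldisjoint a (b [^] n)"
proof (induction n)
  case 0
  then show ?case by (auto simp: ldisjoint_def)
next
  case (Suc n)
  then show ?case using assms ldisjoint_mult[of a "b [^] n" b] by simp
qed

text \<open>A negative exponent in the order-unit axiom already forces
  \<open>x \<preceq> \<one>\<close>, so exponent 0 serves. Natural exponents are what inductions on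
  powers such as \<open>ldisjoint_pow\<close> can handle.\<close>

lemma unit_dominates_nat:
  assumes "x \<in> carrier G" "\<one> \<preceq> x"
  shows "\<exists>n::nat. x \<preceq> order_unit G [^] n"
proof -
  obtain n :: int where n: "x \<preceq> order_unit G [^] n" using unit_dominates assms by blast
  show ?thesis
  proof (cases "n \<ge> 0")
    case True
    then obtain m where "n = int m" by (metis nonneg_int_cases)
    then show ?thesis using n int_pow_int[of G "order_unit G" m] by auto
  next
    case False
    then have eq: "order_unit G [^] n = inv (order_unit G [^] nat (- n))"
      using int_pow_def2[of G "order_unit G" n] by simp
    have "order_unit G [^] n \<preceq> \<one>"
      unfolding eq
      using inv_le_iff[of "order_unit G [^] nat (- n)" \<one>] one_le_pow[OF unit_nonneg unit_closed]
        unit_closed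
      by simp
    then have "x \<preceq> order_unit G [^] (0::nat)"
      using n assms unit_closed le_trans[of x "order_unit G [^] n" \<one>] by simp
    then show ?thesis by blast
  qed
qed

text \<open>Some power of the unit lies above \<open>x\<close>, and disjointness from the unit
  passes to that power; so \<open>x\<close> itself is one of the common lower bounds. The join with
  \<open>\<one>\<close> enters because only positive elements are dominated by axiom.\<close>

lemma le_one_of_ldisjoint_unit:
  assumes "ldisjoint x (order_unit G)" "x \<in> carrier G"
  shows "x \<preceq> \<one>"
proof -
  have y: "ljoin G x \<one> \<in> carrier G" "\<one> \<preceq> ljoin G x \<one>" "x \<preceq> ljoin G x \<one>"
    using assms ljoin_closed ljoin_left ljoin_right by simp_all
  from unit_dominates_nat[OF y(1,2)]
  obtain n :: nat where n: "ljoin G x \<one> \<preceq> order_unit G [^] n" ..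
  have "x \<preceq> order_unit G [^] n"
    by (rule le_trans[OF y(3) n]) (use assms y unit_closed in auto)
  moreover have "ldisjoint x (order_unit G [^] n)"
    using ldisjoint_pow assms unit_closed unit_nonneg by blast
  ultimately show ?thesis using assms le_refl by (auto simp: ldisjoint_def)
qed

text \<open>The positive part lies below \<open>x \<otimes> ?b\<close>, where \<open>?b\<close> is
  the negative part. Hence for a common lower bound \<open>t\<close> the element
  \<open>?b \<otimes> inv t\<close> is above both \<open>inv x\<close> and \<open>\<one>\<close>,
  thus above their join \<open>?b\<close>, and cancelling \<open>?b\<close> leaves
  \<open>t \<preceq> \<one>\<close>.\<close>

lemma ldisjoint_pos_neg:
  assumes [simp]: "x \<in> carrier G"
  shows "ldisjoint (ljoin G x \<one>) (ljoin G (inv x) \<one>)"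
  unfolding ldisjoint_def
proof safe
  fix t
  let ?b = "ljoin G (inv x) \<one>"
  assume [simp]: "t \<in> carrier G" and t: "t \<preceq> ljoin G x \<one>" "t \<preceq> ?b"
  have [simp]: "?b \<in> carrier G" "ljoin G x \<one> \<in> carrier G" by (auto intro: ljoin_closed)
  have "x \<otimes> inv x \<preceq> x \<otimes> ?b" "x \<otimes> \<one> \<preceq> x \<otimes> ?b"
    using ljoin_left[of "inv x" \<one>] ljoin_right[of "inv x" \<one>]
    by (intro mult_le_mono le_refl; simp)+
  then have "ljoin G x \<one> \<preceq> x \<otimes> ?b" by (auto intro: ljoin_least)
  then have "t \<preceq> x \<otimes> ?b" using t by (auto intro: le_trans[of t "ljoin G x \<one>"])
  then have 1: "t \<otimes> inv ?b \<preceq> x" by (simp add: le_mult_iff)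
  have "inv (t \<otimes> inv ?b) = ?b \<otimes> inv t" by (simp add: inv_mult m_comm)
  moreover have "inv x \<preceq> ?b \<otimes> inv t" "\<one> \<preceq> ?b \<otimes> inv t"
    using 1 t inv_le_iff[of x "t \<otimes> inv ?b"] le_mult_iff[of \<one> ?b "inv t"]
    by (simp_all add: calculation)
  ultimately have "?b \<preceq> ?b \<otimes> inv t" by (auto intro: ljoin_least)
  then have "?b \<otimes> t \<preceq> ?b" by (simp add: le_mult_iff)
  then show "t \<preceq> \<one>"
    using translation_invariant[of "?b \<otimes> t" ?b "inv ?b"] by (simp add: m_ac)
qed

end

section \<open>Homomorphisms, the kernel criterion and the simple case\<close>

lemma ul_hom_hom: "h \<in> ul_hom G H \<Longrightarrow> h \<in> hom G H"
  by (simp add: ul_hom_def)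

lemma ul_hom_mono:
  assumes "unital_lgroup G" "unital_lgroup H" "h \<in> ul_hom G H"
    and xy: "x \<preceq>\<^bsub>G\<^esub> y" "x \<in> carrier G" "y \<in> carrier G"
  shows "h x \<preceq>\<^bsub>H\<^esub> h y"
proof -
  interpret G: unital_lgroup G by fact
  interpret H: unital_lgroup H by fact
  have "h x \<in> carrier H" "h y \<in> carrier H"
    using assms(3) xy by (auto simp: ul_hom_def hom_def)
  moreover have "h (ljoin G x y) = ljoin H (h x) (h y)"
    using assms(3) xy by (simp add: ul_hom_def)
  then have "h y = ljoin H (h x) (h y)"
    using xy by (simp add: G.ljoin_absorb)
  ultimately show ?thesis using H.ljoin_left[of "h x" "h y"] by simp
qed

lemma ul_hom_compose:
  assumes "h \<in> ul_hom G H" "k \<in> ul_hom H K"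
  shows "k \<circ> h \<in> ul_hom G K"
proof -
  have "h x \<in> carrier H" if "x \<in> carrier G" for x
    using assms that by (auto simp: ul_hom_def hom_def)
  then show ?thesis using assms by (auto simp: ul_hom_def hom_def)
qed

lemma hopfianI:
  assumes G: "unital_lgroup G"
    and ker: "\<And>h x. \<lbrakk>h \<in> ul_hom G G; h ` carrier G = carrier G; x \<in> carrier G; h x = \<one>\<^bsub>G\<^esub>\<rbrakk>
      \<Longrightarrow> x = \<one>\<^bsub>G\<^esub>"
  shows "hopfian G"
  unfolding hopfian_def
proof safe
  fix h assume h: "h \<in> ul_hom G G" "h ` carrier G = carrier G"
  interpret G: unital_lgroup G by fact
  interpret h: group_hom G G h by unfold_locales (rule ul_hom_hom[OF h(1)])
  have "inj_on h (carrier G)"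
    using ker[OF h] by (auto simp: h.inj_on_one_iff)
  then show "h \<in> ul_iso G G"
    using h by (auto simp: ul_iso_def bij_betw_def)
qed

lemma hopfian_simple:
  assumes "unital_lgroup G" "ul_simple G"
  shows "hopfian G"
proof (rule hopfianI[OF assms(1)])
  fix h x assume h: "h \<in> ul_hom G G" and x: "x \<in> carrier G" "h x = \<one>\<^bsub>G\<^esub>"
  have "kernel G G h = {\<one>\<^bsub>G\<^esub>}"
    using ul_ideal_kernel[OF assms(1,1) h] assms(2) by (auto simp: ul_simple_def)
  then show "x = \<one>\<^bsub>G\<^esub>" using x by (auto simp: kernel_def)
qed

section \<open>Prime ideals\<close>

text \<open>The quotient order only asks for some pair of comparable representatives. If
  \<open>k x\<close> is below \<open>k y\<close>, then the join of \<open>x\<close> and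
  \<open>y\<close> has the same image as \<open>y\<close>, so it is a representative of the coset of
  \<open>y\<close> above \<open>x\<close>. The converse is monotonicity of \<open>k\<close>.\<close>

lemma ul_quotient_leq_iff:
  fixes G :: "'a ulgroup" and H :: "'b ulgroup"
  assumes GH: "unital_lgroup G" "unital_lgroup H" and k: "k \<in> ul_hom G H"
    and xy: "x \<in> carrier G" "y \<in> carrier G"
  defines "I \<equiv> kernel G H k"
  shows "leq (ul_quotient G I) (I #>\<^bsub>G\<^esub> x) (I #>\<^bsub>G\<^esub> y) \<longleftrightarrow> k x \<preceq>\<^bsub>H\<^esub> k y"
proof -
  interpret G: unital_lgroup G by fact
  interpret H: unital_lgroup H by fact
  interpret k: group_hom G H k by unfold_locales (rule ul_hom_hom[OF k])
  have coset: "I #>\<^bsub>G\<^esub> x = {z \<in> carrier G. k z = k x}" if x: "x \<in> carrier G" for x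
  proof safe
    fix z assume "z \<in> I #>\<^bsub>G\<^esub> x"
    then show "z \<in> carrier G" "k z = k x" using x by (auto simp: r_coset_def I_def kernel_def)
  next
    fix z assume z: "z \<in> carrier G" "k z = k x"
    then have "z \<otimes>\<^bsub>G\<^esub> inv\<^bsub>G\<^esub> x \<in> I" "z = (z \<otimes>\<^bsub>G\<^esub> inv\<^bsub>G\<^esub> x) \<otimes>\<^bsub>G\<^esub> x"
      using x by (auto simp: I_def kernel_def G.m_assoc)
    then show "z \<in> I #>\<^bsub>G\<^esub> x" by (auto simp: r_coset_def)
  qed
  have "\<exists>x'\<in>I #>\<^bsub>G\<^esub> x. \<exists>y'\<in>I #>\<^bsub>G\<^esub> y. x' \<preceq>\<^bsub>G\<^esub> y'" if le: "k x \<preceq>\<^bsub>H\<^esub> k y"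
  proof -
    have "k (ljoin G x y) = k y"
      using k xy le H.ljoin_absorb[of "k x" "k y"] by (simp add: ul_hom_def)
    then show ?thesis
      using xy G.ljoin_left[of x y] G.ljoin_closed[of x y] by (auto simp: coset)
  qed
  moreover have "k x \<preceq>\<^bsub>H\<^esub> k y"
    if "\<exists>x'\<in>I #>\<^bsub>G\<^esub> x. \<exists>y'\<in>I #>\<^bsub>G\<^esub> y. x' \<preceq>\<^bsub>G\<^esub> y'"
    using that ul_hom_mono[OF GH k] xy by (auto simp: coset) metis
  ultimately show ?thesis by (auto simp: ul_quotient_def)
qed

text \<open>Primeness can thus be tested in the codomain of any homomorphism with the given kernel,
  without touching cosets again.\<close>

lemma ul_prime_ideal_kernel_iff:
  fixes G :: "'a ulgroup" and H :: "'b ulgroup"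
  assumes GH: "unital_lgroup G" "unital_lgroup H" and k: "k \<in> ul_hom G H"
  shows "ul_prime_ideal G (kernel G H k) \<longleftrightarrow>
    (\<forall>x\<in>carrier G. \<forall>y\<in>carrier G. k x \<preceq>\<^bsub>H\<^esub> k y \<or> k y \<preceq>\<^bsub>H\<^esub> k x)"
proof -
  interpret G: unital_lgroup G by fact
  interpret H: unital_lgroup H by fact
  interpret k: group_hom G H k by unfold_locales (rule ul_hom_hom[OF k])
  define I where "I = kernel G H k"
  note le_iff = ul_quotient_leq_iff[OF GH k, folded I_def]
  have car: "carrier (ul_quotient G I) = (\<lambda>x. I #>\<^bsub>G\<^esub> x) ` carrier G"
    by (simp add: ul_quotient_def carrier_FactGroup)
  have eq: "I #>\<^bsub>G\<^esub> x = I #>\<^bsub>G\<^esub> y" if "k x = k y" "x \<in> carrier G" "y \<in> carrier G" for x y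
  proof -
    have "x \<otimes>\<^bsub>G\<^esub> inv\<^bsub>G\<^esub> y \<in> I" using that by (simp add: I_def kernel_def)
    then have "x \<in> I #>\<^bsub>G\<^esub> y"
      using that by (auto simp: r_coset_def G.m_assoc intro!: bexI[of _ "x \<otimes>\<^bsub>G\<^esub> inv\<^bsub>G\<^esub> y"])
    then show ?thesis
      using that G.repr_independence k.subgroup_kernel unfolding I_def by metis
  qed
  \<comment> \<open>Every kernel gives a partially ordered quotient, so totality comes down to
    comparability alone.\<close>
  have po: "Order.partial_order (lorder (ul_quotient G I))"
  proof
    fix X assume "X \<in> carrier (lorder (ul_quotient G I))"
    then show "X \<sqsubseteq>\<^bsub>lorder (ul_quotient G I)\<^esub> X"
      using H.le_refl by (auto simp: car le_iff)
  next
    fix X Y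
    assume XY: "X \<sqsubseteq>\<^bsub>lorder (ul_quotient G I)\<^esub> Y" "Y \<sqsubseteq>\<^bsub>lorder (ul_quotient G I)\<^esub> X"
      "X \<in> carrier (lorder (ul_quotient G I))" "Y \<in> carrier (lorder (ul_quotient G I))"
    then show "X .=\<^bsub>lorder (ul_quotient G I)\<^esub> Y"
    proof -
      obtain x y where xy: "x \<in> carrier G" "X = I #>\<^bsub>G\<^esub> x" "y \<in> carrier G" "Y = I #>\<^bsub>G\<^esub> y"
        using XY by (auto simp: car)
      then have "k x = k y" using XY by (intro H.le_antisym) (auto simp: le_iff)
      then show ?thesis using eq[of x y] xy by simp
    qed
  next
    fix X Y Z
    assume "X \<sqsubseteq>\<^bsub>lorder (ul_quotient G I)\<^esub> Y" "Y \<sqsubseteq>\<^bsub>lorder (ul_quotient G I)\<^esub> Z"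
      "X \<in> carrier (lorder (ul_quotient G I))" "Y \<in> carrier (lorder (ul_quotient G I))"
      "Z \<in> carrier (lorder (ul_quotient G I))"
    then obtain x y z where
      *: "x \<in> carrier G" "y \<in> carrier G" "z \<in> carrier G"
        "X = I #>\<^bsub>G\<^esub> x" "Y = I #>\<^bsub>G\<^esub> y" "Z = I #>\<^bsub>G\<^esub> z"
        "k x \<preceq>\<^bsub>H\<^esub> k y" "k y \<preceq>\<^bsub>H\<^esub> k z"
      by (auto simp: car le_iff)
    then have "k x \<preceq>\<^bsub>H\<^esub> k z" using H.le_trans[of "k x" "k y" "k z"] by simp
    then show "X \<sqsubseteq>\<^bsub>lorder (ul_quotient G I)\<^esub> Z" using * by (simp add: le_iff)
  qed auto
  have "ul_prime_ideal G I \<longleftrightarrow> Order.total_order (lorder (ul_quotient G I))"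
    using ul_ideal_kernel[OF GH k] by (simp add: ul_prime_ideal_def I_def)
  also have "\<dots> \<longleftrightarrow> (\<forall>X\<in>carrier (ul_quotient G I). \<forall>Y\<in>carrier (ul_quotient G I).
      leq (ul_quotient G I) X Y \<or> leq (ul_quotient G I) Y X)"
    using po by (auto simp: total_order_def total_order_axioms_def)
  also have "\<dots> \<longleftrightarrow> (\<forall>x\<in>carrier G. \<forall>y\<in>carrier G. k x \<preceq>\<^bsub>H\<^esub> k y \<or> k y \<preceq>\<^bsub>H\<^esub> k x)"
    by (auto simp: car le_iff)
  finally show ?thesis by (simp add: I_def)
qed

context unital_lgroup
begin

section \<open>Prime ideals from submonoids of the positive cone\<close>

text \<open>The ideal consists of the elements whose absolute value is bounded by a member of
  \<open>P\<close>. Assumption \<open>total\<close> makes its quotient a chain, where joins and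
  meets are just the larger and the smaller element; assumption \<open>unit\<close> keeps the
  quotient nontrivial.\<close>

lemma prime_ideal_of_cone:
  assumes P: "\<And>p. p \<in> P \<Longrightarrow> p \<in> carrier G" "\<And>p. p \<in> P \<Longrightarrow> \<one> \<preceq> p" "\<one> \<in> P"
      "\<And>p q. \<lbrakk>p \<in> P; q \<in> P\<rbrakk> \<Longrightarrow> p \<otimes> q \<in> P"
    and total: "\<And>x. x \<in> carrier G \<Longrightarrow> \<exists>p\<in>P. x \<preceq> p \<or> inv x \<preceq> p"
    and unit: "\<And>p. p \<in> P \<Longrightarrow> \<not> order_unit G \<preceq> p"
  shows "ul_prime_ideal G {x \<in> carrier G. \<exists>p\<in>P. x \<preceq> p \<and> inv x \<preceq> p}"
proof -
  define I where "I = {x \<in> carrier G. \<exists>p\<in>P. x \<preceq> p \<and> inv x \<preceq> p}"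
  define Q where "Q = ul_quotient G I"
  define q where "q x = I #> x" for x
  have I_closed: "x \<in> carrier G" if "x \<in> I" for x using that by (simp add: I_def)
  have P_I: "p \<in> I" if "p \<in> P" for p
  proof -
    have "inv p \<preceq> \<one>" using inv_le_iff[of p \<one>] P that by simp
    then have "inv p \<preceq> p" using P(1,2) that by (auto intro: le_trans[of "inv p" \<one> p])
    then show ?thesis using P(1)[OF that] that le_refl[of p] by (auto simp: I_def intro!: bexI[of _ p])
  qed
  have sub: "subgroup I G"
  proof
    fix x y assume "x \<in> I" "y \<in> I"
    then obtain p p' where *: "x \<in> carrier G" "y \<in> carrier G" "p \<in> P" "p' \<in> P"
      "x \<preceq> p" "inv x \<preceq> p" "y \<preceq> p'" "inv y \<preceq> p'" by (auto simp: I_def)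
    then have "x \<otimes> y \<preceq> p \<otimes> p'" "inv x \<otimes> inv y \<preceq> p \<otimes> p'"
      using P by (auto intro: mult_le_mono)
    then show "x \<otimes> y \<in> I" using * P by (auto simp: I_def inv_mult)
  qed (use P_I[OF P(3)] in \<open>auto simp: I_def\<close>)
  have normal: "I \<lhd> G" using sub by (simp add: normal_iff_subgroup)
  have Q_car: "carrier Q = q ` carrier G"
    by (simp add: Q_def ul_quotient_def carrier_FactGroup q_def[abs_def])
  have Q_one: "\<one>\<^bsub>Q\<^esub> = q \<one>"
    using I_closed by (simp add: Q_def ul_quotient_def q_def coset_mult_one subset_iff)
  have Q_unit: "order_unit Q = q (order_unit G)"
    by (simp add: Q_def ul_quotient_def q_def)
  have Q_mult: "q x \<otimes>\<^bsub>Q\<^esub> q y = q (x \<otimes> y)" if "x \<in> carrier G" "y \<in> carrier G" for x y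
    using normal.rcos_sum[OF normal that] by (simp add: Q_def ul_quotient_def q_def)
  \<comment> \<open>Coset representatives are absorbed into a single element of \<open>P\<close>:
    \<open>inv i\<close> and \<open>j\<close> are bounded by members of \<open>P\<close>, whose
    product is again in \<open>P\<close>.\<close>
  have le_iff: "q x \<preceq>\<^bsub>Q\<^esub> q y \<longleftrightarrow> (\<exists>p\<in>P. x \<preceq> p \<otimes> y)"
    if xy: "x \<in> carrier G" "y \<in> carrier G" for x y
  proof -
    have "q x \<preceq>\<^bsub>Q\<^esub> q y \<longleftrightarrow> (\<exists>i\<in>I. \<exists>j\<in>I. i \<otimes> x \<preceq> j \<otimes> y)"
      by (auto simp: Q_def ul_quotient_def q_def r_coset_def)
    also have "\<dots> \<longleftrightarrow> (\<exists>p\<in>P. x \<preceq> p \<otimes> y)"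
    proof safe
      fix i j assume ij: "i \<in> I" "j \<in> I" "i \<otimes> x \<preceq> j \<otimes> y"
      then obtain p p' where p: "p \<in> P" "p' \<in> P" "inv i \<preceq> p" "j \<preceq> p'"
        unfolding I_def by blast
      note c = xy ij(1,2)[THEN I_closed] p(1,2)[THEN P(1)]
      have "inv i \<otimes> (i \<otimes> x) \<preceq> p \<otimes> (p' \<otimes> y)"
      proof (rule mult_le_mono)
        show "i \<otimes> x \<preceq> p' \<otimes> y"
        proof (rule le_trans[OF ij(3)])
          show "j \<otimes> y \<preceq> p' \<otimes> y" using c p(4) by (simp add: translation_invariant)
        qed (use c in simp_all)
      qed (use c p in simp_all)
      moreover have "inv i \<otimes> (i \<otimes> x) = x" "p \<otimes> (p' \<otimes> y) = (p \<otimes> p') \<otimes> y"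
        using c by (simp_all add: m_assoc[symmetric])
      ultimately show "\<exists>p\<in>P. x \<preceq> p \<otimes> y" using P(4)[OF p(1,2)] by auto
    next
      fix p assume "p \<in> P" "x \<preceq> p \<otimes> y"
      then show "\<exists>i\<in>I. \<exists>j\<in>I. i \<otimes> x \<preceq> j \<otimes> y"
        using P_I P(3) xy by (intro bexI[of _ \<one>] bexI[of _ p]) auto
    qed
    finally show ?thesis .
  qed
  \<comment> \<open>The two bounds on \<open>x \<otimes> inv y\<close> and on its inverse come from
    different members of \<open>P\<close>; their product bounds both, as members of \<open>P\<close>
    are positive.\<close>
  have q_eq: "q x = q y" if *: "q x \<preceq>\<^bsub>Q\<^esub> q y" "q y \<preceq>\<^bsub>Q\<^esub> q x"
    and xy: "x \<in> carrier G" "y \<in> carrier G" for x y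
  proof -
    obtain p p' where p: "p \<in> P" "p' \<in> P" "x \<preceq> p \<otimes> y" "y \<preceq> p' \<otimes> x"
      using * xy by (auto simp: le_iff)
    note c = xy p(1,2)[THEN P(1)]
    have "x \<otimes> inv y \<preceq> p" "y \<otimes> inv x \<preceq> p'"
      using p c by (simp_all add: le_mult_iff)
    moreover have "p \<preceq> p \<otimes> p'" "p' \<preceq> p \<otimes> p'"
      using c p P le_mult_right le_mult_left by auto
    ultimately have "x \<otimes> inv y \<preceq> p \<otimes> p'" "y \<otimes> inv x \<preceq> p \<otimes> p'"
      using c by (auto intro: le_trans[of _ p] le_trans[of _ p'])
    moreover have "inv (x \<otimes> inv y) = y \<otimes> inv x"
      using c m_comm[of "inv x" y] by (simp add: inv_mult)
    ultimately have "x \<otimes> inv y \<in> I"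
      using c P(4)[OF p(1,2)] by (simp add: I_def) (rule bexI[of _ "p \<otimes> p'"]; simp)
    moreover have "x = (x \<otimes> inv y) \<otimes> y" using c by (simp add: m_assoc)
    ultimately have "x \<in> I #> y" by (auto simp: r_coset_def)
    then show ?thesis using repr_independence[OF _ _ sub] xy by (simp add: q_def)
  qed
  have lin: "q x \<preceq>\<^bsub>Q\<^esub> q y \<or> q y \<preceq>\<^bsub>Q\<^esub> q x" if xy: "x \<in> carrier G" "y \<in> carrier G" for x y
  proof -
    obtain p where "p \<in> P" "x \<otimes> inv y \<preceq> p \<or> inv (x \<otimes> inv y) \<preceq> p"
      using total[of "x \<otimes> inv y"] xy by auto
    moreover have "inv (x \<otimes> inv y) = y \<otimes> inv x"
      using xy m_comm[of "inv x" y] by (simp add: inv_mult)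
    ultimately show ?thesis
      using xy P(1)[of p] le_mult_iff[of x p y] le_mult_iff[of y p x] by (auto simp: le_iff)
  qed
  have "Order.total_order (lorder Q)"
  proof
    fix X Y
    assume XY: "X \<sqsubseteq>\<^bsub>lorder Q\<^esub> Y" "Y \<sqsubseteq>\<^bsub>lorder Q\<^esub> X"
      "X \<in> carrier (lorder Q)" "Y \<in> carrier (lorder Q)"
    then show "X .=\<^bsub>lorder Q\<^esub> Y" using q_eq by (auto simp: Q_car)
  next
    fix X Y Z
    assume XYZ: "X \<sqsubseteq>\<^bsub>lorder Q\<^esub> Y" "Y \<sqsubseteq>\<^bsub>lorder Q\<^esub> Z"
      "X \<in> carrier (lorder Q)" "Y \<in> carrier (lorder Q)" "Z \<in> carrier (lorder Q)"
    then obtain x y z p p' where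
      *: "x \<in> carrier G" "y \<in> carrier G" "z \<in> carrier G" "X = q x" "Y = q y" "Z = q z"
        "p \<in> P" "p' \<in> P" "x \<preceq> p \<otimes> y" "y \<preceq> p' \<otimes> z"
      by (auto simp: Q_car le_iff)
    have "p \<otimes> y \<preceq> p \<otimes> (p' \<otimes> z)" using * P by (intro mult_le_mono le_refl) auto
    then have "x \<preceq> (p \<otimes> p') \<otimes> z"
      using * P by (auto simp: m_assoc intro: le_trans[of x "p \<otimes> y"])
    then show "X \<sqsubseteq>\<^bsub>lorder Q\<^esub> Z" using * P(4) by (auto simp: le_iff)
  next
    fix X Y assume "X \<in> carrier (lorder Q)" "Y \<in> carrier (lorder Q)"
    then show "X \<sqsubseteq>\<^bsub>lorder Q\<^esub> Y \<or> Y \<sqsubseteq>\<^bsub>lorder Q\<^esub> X" using lin by (auto simp: Q_car)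
  next
    fix X assume "X \<in> carrier (lorder Q)"
    then show "X \<sqsubseteq>\<^bsub>lorder Q\<^esub> X" using lin by (auto simp: Q_car)
  qed auto
  then interpret QL: Order.total_order "lorder Q" .
  have Q_group: "comm_group Q"
  proof (rule comm_groupI)
    fix X assume "X \<in> carrier Q"
    then obtain x where x: "x \<in> carrier G" "X = q x" by (auto simp: Q_car)
    then show "\<exists>Y\<in>carrier Q. Y \<otimes>\<^bsub>Q\<^esub> X = \<one>\<^bsub>Q\<^esub>"
      by (intro bexI[of _ "q (inv x)"]) (auto simp: Q_car Q_one Q_mult)
  qed (auto simp: Q_car Q_one Q_mult m_ac)
  interpret Q: comm_group Q by (rule Q_group)
  have q_hom: "q \<in> hom G Q" by (auto simp: hom_def Q_car Q_mult)
  have q_mono: "q x \<preceq>\<^bsub>Q\<^esub> q y" if "x \<preceq> y" "x \<in> carrier G" "y \<in> carrier G" for x y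
    using that P(3) by (auto simp: le_iff intro!: bexI[of _ \<one>])
  have "unital_lgroup Q"
  proof (intro unital_lgroup.intro[OF Q_group] unital_lgroup_axioms.intro)
    show "Lattice.lattice (lorder Q)" by unfold_locales
  next
    fix X Y Z assume "X \<in> carrier Q" "Y \<in> carrier Q" "Z \<in> carrier Q" "X \<preceq>\<^bsub>Q\<^esub> Y"
    then obtain x y z p where *: "x \<in> carrier G" "y \<in> carrier G" "z \<in> carrier G"
      "X = q x" "Y = q y" "Z = q z" "p \<in> P" "x \<preceq> p \<otimes> y" by (auto simp: Q_car le_iff)
    then have "x \<otimes> z \<preceq> p \<otimes> (y \<otimes> z)"
      using translation_invariant[of x "p \<otimes> y" z] P by (simp add: m_assoc)
    then show "X \<otimes>\<^bsub>Q\<^esub> Z \<preceq>\<^bsub>Q\<^esub> Y \<otimes>\<^bsub>Q\<^esub> Z" using * by (auto simp: Q_mult le_iff)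
  next
    fix X assume "X \<in> carrier Q"
    then obtain x where x: "x \<in> carrier G" "X = q x" by (auto simp: Q_car)
    have j: "ljoin G x \<one> \<in> carrier G" "\<one> \<preceq> ljoin G x \<one>" "x \<preceq> ljoin G x \<one>"
      using x ljoin_closed ljoin_left ljoin_right by simp_all
    from unit_dominates[OF j(1,2)] obtain n :: int where n: "ljoin G x \<one> \<preceq> order_unit G [^] n" ..
    have "x \<preceq> order_unit G [^] n" by (rule le_trans[OF j(3) n]) (use x j unit_closed in auto)
    then have "q x \<preceq>\<^bsub>Q\<^esub> q (order_unit G [^] n)" using x unit_closed by (intro q_mono) auto
    moreover have "q (order_unit G [^] n) = order_unit Q [^]\<^bsub>Q\<^esub> n"
      using hom_int_pow[OF q_hom unit_closed] is_group Q.is_group by (simp add: Q_unit)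
    ultimately show "\<exists>n::int. X \<preceq>\<^bsub>Q\<^esub> order_unit Q [^]\<^bsub>Q\<^esub> n" using x by auto
  next
    have "\<not> q (order_unit G) \<preceq>\<^bsub>Q\<^esub> q \<one>"
      using unit P(1) unit_closed by (auto simp: le_iff)
    then have "q (order_unit G) \<noteq> q \<one>"
      using lin[of \<one> \<one>] by auto
    then show "carrier Q \<noteq> {\<one>\<^bsub>Q\<^esub>}" using unit_closed by (auto simp: Q_car Q_one)
  qed (use unit_closed unit_nonneg in \<open>auto simp: Q_car Q_unit Q_one intro: q_mono\<close>)
  then interpret Q: unital_lgroup Q .
  \<comment> \<open>From \<open>x \<preceq> p \<otimes> y\<close> the join of \<open>x\<close> and
    \<open>y\<close> is also below \<open>p \<otimes> y\<close>, and dually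
    \<open>x \<otimes> inv p\<close> is below their meet. Modulo the ideal the factor
    \<open>p\<close> disappears.\<close>
  have lattice_hom: "q (ljoin G x y) = q y \<and> q (lmeet G x y) = q x"
    if xy: "x \<in> carrier G" "y \<in> carrier G" and le: "q x \<preceq>\<^bsub>Q\<^esub> q y" for x y
  proof -
    obtain p where p: "p \<in> P" "x \<preceq> p \<otimes> y" using le xy by (auto simp: le_iff)
    note c = xy P(1)[OF p(1)] ljoin_closed[OF xy] lmeet_closed[OF xy]
    have "ljoin G x y \<preceq> p \<otimes> y"
      using p P(2) c le_mult_left by (intro ljoin_least) auto
    then have "q (ljoin G x y) \<preceq>\<^bsub>Q\<^esub> q y" using c p by (auto simp: le_iff)
    then have 1: "q (ljoin G x y) = q y"
      using c q_mono[OF ljoin_right[OF xy]] by (intro q_eq) auto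
    have "x \<otimes> inv p \<preceq> y" using p c le_mult_iff[of x y p] by (simp add: m_comm)
    moreover have "x \<otimes> inv p \<preceq> x"
      using le_mult_iff[of x x p] le_mult_right[of p x] P(2)[OF p(1)] c by simp
    ultimately have "x \<otimes> inv p \<preceq> lmeet G x y" using c by (intro lmeet_greatest) auto
    then have "x \<preceq> p \<otimes> lmeet G x y"
      using c le_mult_iff[of x "lmeet G x y" p] by (simp add: m_comm)
    then have "q x \<preceq>\<^bsub>Q\<^esub> q (lmeet G x y)" using c p by (auto simp: le_iff)
    then have 2: "q (lmeet G x y) = q x"
      using c q_mono[OF lmeet_left[OF xy]] by (intro q_eq) auto
    show ?thesis using 1 2 by simp
  qed
  have "q \<in> ul_hom G Q"
  proof -
    have "q (ljoin G x y) = ljoin Q (q x) (q y) \<and> q (lmeet G x y) = lmeet Q (q x) (q y)"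
      if xy: "x \<in> carrier G" "y \<in> carrier G" for x y
    proof -
      have c: "q x \<in> carrier Q" "q y \<in> carrier Q" using xy by (auto simp: Q_car)
      show ?thesis
        using lin[OF xy]
      proof
        assume "q x \<preceq>\<^bsub>Q\<^esub> q y"
        then show ?thesis
          using lattice_hom xy c Q.ljoin_absorb[of "q x" "q y"] Q.lmeet_absorb1[of "q x" "q y"] by simp
      next
        assume "q y \<preceq>\<^bsub>Q\<^esub> q x"
        then show ?thesis
          using lattice_hom[of y x] xy c Q.ljoin_absorb[of "q y" "q x"]
            Q.lmeet_absorb1[of "q y" "q x"] by (simp add: join_comm meet_comm)
      qed
    qed
    then show ?thesis using q_hom by (auto simp: ul_hom_def Q_unit)
  qed
  moreover have "kernel G Q q = I"
  proof -
    have "q x = q \<one> \<longleftrightarrow> x \<in> I" if "x \<in> carrier G" for x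
      using that sub coset_join1[of I x] coset_join2[of x I] I_closed
      by (auto simp: q_def coset_mult_one subset_iff)
    then show ?thesis unfolding kernel_def Q_one using I_closed by blast
  qed
  moreover have "ul_prime_ideal G (kernel G Q q)"
    using ul_prime_ideal_kernel_iff[OF unital_lgroup_axioms Q.unital_lgroup_axioms calculation(1)]
      lin by blast
  ultimately show ?thesis by (simp add: I_def)
qed

text \<open>
  The cone is a maximal submonoid of the positive cone none of whose elements dominates \<open>x0\<close>.
\<close>

lemma prime_ideal_avoiding:
  assumes x0: "x0 \<in> carrier G" "\<not> x0 \<preceq> \<one>"
  shows "\<exists>I. ul_prime_ideal G I \<and> x0 \<notin> I"
proof -
  define A where "A = {P. P \<subseteq> {p \<in> carrier G. \<one> \<preceq> p} \<and> \<one> \<in> P \<and>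
    (\<forall>p\<in>P. \<forall>q\<in>P. p \<otimes> q \<in> P) \<and> (\<forall>p\<in>P. \<not> x0 \<preceq> p)}"
  have "{\<one>} \<in> A" using x0 le_refl by (auto simp: A_def)
  moreover have "\<Union>C \<in> A" if C: "C \<noteq> {}" "subset.chain A C" for C
  proof -
    have CA: "C \<subseteq> A" and ch: "\<And>X Y. \<lbrakk>X \<in> C; Y \<in> C\<rbrakk> \<Longrightarrow> X \<subseteq> Y \<or> Y \<subseteq> X"
      using C by (auto simp: subset_chain_def)
    have "p \<otimes> q \<in> \<Union>C" if pq: "p \<in> \<Union>C" "q \<in> \<Union>C" for p q
    proof -
      obtain X Y where "X \<in> C" "Y \<in> C" "p \<in> X" "q \<in> Y" using pq by auto
      then obtain Z where "Z \<in> C" "p \<in> Z" "q \<in> Z" using ch by blast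
      then show ?thesis using CA by (auto simp: A_def)
    qed
    moreover have "\<Union>C \<subseteq> {p \<in> carrier G. \<one> \<preceq> p}" "\<one> \<in> \<Union>C" "\<forall>p\<in>\<Union>C. \<not> x0 \<preceq> p"
      using C CA unfolding A_def by blast+
    ultimately show ?thesis by (simp add: A_def)
  qed
  ultimately obtain P where "P \<in> A" and max: "\<And>X. \<lbrakk>X \<in> A; P \<subseteq> X\<rbrakk> \<Longrightarrow> X = P"
    using subset_Zorn_nonempty[of A] by blast
  then have P: "\<And>p. p \<in> P \<Longrightarrow> p \<in> carrier G" "\<And>p. p \<in> P \<Longrightarrow> \<one> \<preceq> p" "\<one> \<in> P"
      "\<And>p q. \<lbrakk>p \<in> P; q \<in> P\<rbrakk> \<Longrightarrow> p \<otimes> q \<in> P" "\<And>p. p \<in> P \<Longrightarrow> \<not> x0 \<preceq> p"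
    by (auto simp: A_def)
  \<comment> \<open>Otherwise the products \<open>p \<otimes> a [^] n\<close> would form a strictly
    larger member of \<open>A\<close>, the submonoid generated by \<open>P\<close> and
    \<open>a\<close>.\<close>
  have ext: "\<exists>p\<in>P. \<exists>n::nat. x0 \<preceq> p \<otimes> a [^] n"
    if a: "a \<in> carrier G" "\<one> \<preceq> a" "a \<notin> P" for a
  proof (rule ccontr)
    assume neg: "\<not> ?thesis"
    define R where "R = {p \<otimes> a [^] n |p n. p \<in> P \<and> n \<in> (UNIV::nat set)}"
    have RI: "p \<otimes> a [^] (n::nat) \<in> R" if "p \<in> P" for p n using that by (auto simp: R_def)
    have "P \<subseteq> R" using RI[of _ 0] P(1) by auto
    moreover have "a \<in> R" using RI[OF P(3), of 1] a by simp
    moreover have "R \<in> A"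
      unfolding A_def
    proof (intro CollectI conjI ballI)
      show "R \<subseteq> {p \<in> carrier G. \<one> \<preceq> p}"
        using P a by (auto simp: R_def intro!: one_le_mult one_le_pow)
      show "\<one> \<in> R" using \<open>P \<subseteq> R\<close> P(3) by auto
      show "\<not> x0 \<preceq> r" if "r \<in> R" for r using that neg by (auto simp: R_def)
      fix r s assume "r \<in> R" "s \<in> R"
      then obtain p m q n where r: "p \<in> P" "q \<in> P" "r = p \<otimes> a [^] (m::nat)" "s = q \<otimes> a [^] (n::nat)"
        by (auto simp: R_def)
      then have "r \<otimes> s = (p \<otimes> q) \<otimes> a [^] (m + n)"
        using P(1) a by (simp add: nat_pow_mult[symmetric] m_ac)
      then show "r \<otimes> s \<in> R" using RI P(4) r by auto
    qed
    ultimately show False using max a by blast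
  qed
  have total: "\<exists>p\<in>P. x \<preceq> p \<or> inv x \<preceq> p" if x: "x \<in> carrier G" for x
  proof -
    let ?a = "ljoin G x \<one>" and ?b = "ljoin G (inv x) \<one>"
    have c: "?a \<in> carrier G" "?b \<in> carrier G" "\<one> \<preceq> ?a" "\<one> \<preceq> ?b" "x \<preceq> ?a" "inv x \<preceq> ?b"
      using x ljoin_closed ljoin_left ljoin_right by simp_all
    \<comment> \<open>If \<open>P\<close> contained neither the positive nor the negative part of
      \<open>x\<close>, then by \<open>ext\<close> the element
      \<open>x0 \<otimes> inv (p \<otimes> q)\<close> would lie below powers of both. These powers
      are disjoint, so \<open>x0\<close> would lie below \<open>p \<otimes> q\<close>, a member of
      \<open>P\<close>.\<close>
    have "?a \<in> P \<or> ?b \<in> P"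
    proof (rule ccontr)
      assume "\<not> ?thesis"
      then obtain p q m n where pq: "p \<in> P" "q \<in> P"
        "x0 \<preceq> p \<otimes> ?a [^] (m::nat)" "x0 \<preceq> q \<otimes> ?b [^] (n::nat)"
        using ext c by meson
      note d = c x0(1) pq(1,2)[THEN P(1)]
      have "p \<otimes> ?a [^] m \<preceq> (p \<otimes> q) \<otimes> ?a [^] m" "q \<otimes> ?b [^] n \<preceq> (p \<otimes> q) \<otimes> ?b [^] n"
        using d pq P(2) le_mult_right le_mult_left by (auto intro!: mult_le_mono le_refl)
      then have "x0 \<preceq> (p \<otimes> q) \<otimes> ?a [^] m" "x0 \<preceq> (p \<otimes> q) \<otimes> ?b [^] n"
        using pq d le_trans[of x0 "p \<otimes> ?a [^] m"] le_trans[of x0 "q \<otimes> ?b [^] n"] by simp_all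
      then have "x0 \<otimes> inv (p \<otimes> q) \<preceq> ?a [^] m" "x0 \<otimes> inv (p \<otimes> q) \<preceq> ?b [^] n"
        using d le_mult_iff[of x0 "?a [^] m" "p \<otimes> q"] le_mult_iff[of x0 "?b [^] n" "p \<otimes> q"]
        by (simp_all add: m_comm)
      moreover have "ldisjoint (?a [^] m) (?b [^] n)"
        using ldisjoint_pow[of "?b [^] n" ?a m] ldisjoint_pow[of ?a ?b n] ldisjoint_pos_neg[OF x] c
        by (simp add: ldisjoint_commute[of _ ?a] ldisjoint_commute[of _ "?a [^] m"])
      ultimately have "x0 \<otimes> inv (p \<otimes> q) \<preceq> \<one>" using d by (simp add: ldisjoint_def)
      then have "x0 \<preceq> p \<otimes> q" using le_mult_iff[of x0 \<one> "p \<otimes> q"] d by simp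
      then show False using P(4,5) pq by blast
    qed
    then show ?thesis using c by blast
  qed
  \<comment> \<open>If some \<open>p\<close> in \<open>P\<close> dominated the unit, its powers,
    which stay in \<open>P\<close>, would dominate the powers of the unit and one of them
    \<open>x0\<close>.\<close>
  have unit: "\<not> order_unit G \<preceq> p" if p: "p \<in> P" for p
  proof
    assume le: "order_unit G \<preceq> p"
    have y: "ljoin G x0 \<one> \<in> carrier G" "\<one> \<preceq> ljoin G x0 \<one>" "x0 \<preceq> ljoin G x0 \<one>"
      using x0 ljoin_closed ljoin_left ljoin_right by simp_all
    from unit_dominates_nat[OF y(1,2)]
    obtain n :: nat where n: "ljoin G x0 \<one> \<preceq> order_unit G [^] n" ..
    have "order_unit G [^] k \<preceq> p [^] k \<and> p [^] k \<in> P" for k :: nat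
      using le p P unit_closed by (induction k) (auto intro: le_refl mult_le_mono)
    then have "x0 \<preceq> p [^] n" "p [^] n \<in> P"
      using y n x0 p P(1) unit_closed
      by (auto intro!: le_trans[OF le_trans[OF y(3) n]])
    then show False using P(5) by blast
  qed
  have "ul_prime_ideal G {x \<in> carrier G. \<exists>p\<in>P. x \<preceq> p \<and> inv x \<preceq> p}"
    using P(1-4) total unit by (rule prime_ideal_of_cone)
  moreover have "x0 \<notin> {x \<in> carrier G. \<exists>p\<in>P. x \<preceq> p \<and> inv x \<preceq> p}"
    using P(5) by blast
  ultimately show ?thesis by blast
qed

end

section \<open>Pullback of prime ideals and the case of finite spectrum\<close>

lemma prime_ideal_subset: "ul_prime_ideal G I \<Longrightarrow> I \<subseteq> carrier G"
  by (auto simp: ul_prime_ideal_def ul_ideal_def kernel_def)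

text \<open>If \<open>I\<close> is the kernel of \<open>k\<close>, the pullback is the kernel of
  \<open>k \<circ> h\<close>, and comparability of all values of \<open>k\<close> includes that of
  the values \<open>k (h x)\<close>.\<close>

lemma prime_ideal_pullback:
  fixes G :: "'a ulgroup"
  assumes G: "unital_lgroup G" and h: "h \<in> ul_hom G G" and I: "ul_prime_ideal G I"
  shows "ul_prime_ideal G {x \<in> carrier G. h x \<in> I}"
proof -
  have hc: "h x \<in> carrier G" if "x \<in> carrier G" for x
    using h that by (auto simp: ul_hom_def hom_def)
  obtain K :: "'a set ulgroup" and k where
    K: "unital_lgroup K" "k \<in> ul_hom G K" "I = kernel G K k"
    using I unfolding ul_prime_ideal_def ul_ideal_def by blast
  have "kernel G K (k \<circ> h) = {x \<in> carrier G. h x \<in> I}"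
    using hc by (auto simp: K kernel_def)
  moreover have "ul_prime_ideal G (kernel G K (k \<circ> h))"
    using ul_prime_ideal_kernel_iff[OF G K(1,2)] I hc
      ul_prime_ideal_kernel_iff[OF G K(1) ul_hom_compose[OF h K(2)]]
    by (simp add: K(3))
  ultimately show ?thesis by simp
qed

lemma hopfian_finite_spectrum:
  fixes G :: "'a ulgroup"
  assumes G: "unital_lgroup G" and fin: "finite {P. ul_prime_ideal G P}"
  shows "hopfian G"
proof (rule hopfianI[OF G])
  interpret unital_lgroup G by fact
  fix h x
  assume h: "h \<in> ul_hom G G" "h ` carrier G = carrier G" and x: "x \<in> carrier G" "h x = \<one>\<^bsub>G\<^esub>"
  interpret h: group_hom G G h by unfold_locales (rule ul_hom_hom[OF h(1)])
  let ?pb = "\<lambda>I. {x \<in> carrier G. h x \<in> I}"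
  \<comment> \<open>Surjectivity of \<open>h\<close> recovers \<open>I\<close> from its preimage,
    which makes \<open>?pb\<close> injective.\<close>
  have "h ` ?pb I = I" if "ul_prime_ideal G I" for I
    using prime_ideal_subset[OF that] h(2) by (auto simp: image_iff)
  then have "inj_on ?pb {P. ul_prime_ideal G P}"
    by (metis (no_types, lifting) inj_on_def mem_Collect_eq)
  then have surj: "?pb ` {P. ul_prime_ideal G P} = {P. ul_prime_ideal G P}"
    by (intro endo_inj_surj fin) (auto intro: prime_ideal_pullback[OF G h(1)])
  have one: "\<one>\<^bsub>G\<^esub> \<in> I" if I: "ul_prime_ideal G I" for I
  proof -
    obtain K :: "'a set ulgroup" and k where
      K: "unital_lgroup K" "k \<in> ul_hom G K" "I = kernel G K k"
      using I unfolding ul_prime_ideal_def ul_ideal_def by blast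
    interpret K: unital_lgroup K by fact
    interpret k: group_hom G K k by unfold_locales (rule ul_hom_hom[OF K(2)])
    show ?thesis by (simp add: K(3) kernel_def)
  qed
  \<comment> \<open>A prime ideal avoiding \<open>y\<close> would be a preimage under
    \<open>h\<close>, yet every such preimage contains the kernel of \<open>h\<close>. Only one
    inequality results, so it is applied to \<open>x\<close> and to its inverse.\<close>
  have le: "y \<preceq>\<^bsub>G\<^esub> \<one>\<^bsub>G\<^esub>" if y: "y \<in> carrier G" "h y = \<one>\<^bsub>G\<^esub>" for y
  proof (rule ccontr)
    assume "\<not> ?thesis"
    then obtain I where I: "ul_prime_ideal G I" "y \<notin> I" using prime_ideal_avoiding y by blast
    then obtain J where "ul_prime_ideal G J" "I = ?pb J" using surj by blast
    then show False using I y one by auto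
  qed
  have "inv\<^bsub>G\<^esub> x \<preceq>\<^bsub>G\<^esub> \<one>\<^bsub>G\<^esub>" using le[of "inv\<^bsub>G\<^esub> x"] x by simp
  then have "\<one>\<^bsub>G\<^esub> \<preceq>\<^bsub>G\<^esub> x" using inv_le_iff[of x "\<one>\<^bsub>G\<^esub>"] x by simp
  then show "x = \<one>\<^bsub>G\<^esub>" using le[of x] x le_antisym by simp
qed

section \<open>Generation of McNaughton functions by the coordinates\<close>

text \<open>A piece that differs from \<open>f\<close> at \<open>x0\<close> stays apart from
  \<open>f\<close> near \<open>x0\<close>, by continuity and the Hausdorff property. There are
  finitely many pieces, so close to \<open>x0\<close> only those through the point
  \<open>f x0\<close> remain.\<close>

lemma eventually_common_piece:
  fixes f :: "'a::topological_space \<Rightarrow> 'b::t2_space"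
  assumes f: "continuous_on S f" and P: "finite P" "\<And>p. p \<in> P \<Longrightarrow> continuous_on S p"
    and pieces: "\<And>x. x \<in> S \<Longrightarrow> \<exists>p\<in>P. f x = p x" and x0: "x0 \<in> S"
  shows "\<forall>\<^sub>F x in at x0 within S. \<exists>p\<in>P. f x = p x \<and> f x0 = p x0"
proof -
  have "\<forall>\<^sub>F x in at x0 within S. f x = p x \<longrightarrow> f x0 = p x0" if p: "p \<in> P" for p
  proof (cases "f x0 = p x0")
    case False
    obtain U V where UV: "open U" "open V" "f x0 \<in> U" "p x0 \<in> V" "U \<inter> V = {}"
      using hausdorff[OF False] by blast
    have "\<forall>\<^sub>F x in at x0 within S. f x \<in> U" "\<forall>\<^sub>F x in at x0 within S. p x \<in> V"
      using f P(2)[OF p] x0 UV by (auto simp: continuous_on_def intro: topological_tendstoD)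
    then show ?thesis by eventually_elim (use UV in auto)
  qed simp
  then have "\<forall>\<^sub>F x in at x0 within S. \<forall>p\<in>P. f x = p x \<longrightarrow> f x0 = p x0"
    using P(1) by (intro eventually_ball_finite) auto
  moreover have "\<forall>\<^sub>F x in at x0 within S. x \<in> S"
    by (simp add: eventually_at_filter)
  ultimately show ?thesis by eventually_elim (use pieces in metis)
qed

text \<open>Otherwise every zero of \<open>f\<close> would be a crossing from negative to positive values.\<close>

lemma exists_descending_piece:
  fixes f :: "real \<Rightarrow> real" and P :: "(real \<times> real) set"
  assumes f: "continuous_on {0..1} f" "f 0 = 0" "f 1 = 0" and P: "finite P"
    and pieces: "\<And>t. t \<in> {0..1} \<Longrightarrow> \<exists>(a, b)\<in>P. f t = (1 - t) * a + t * b"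
  shows "\<exists>(a, b)\<in>P. 0 \<le> a \<and> b \<le> 0"
proof (rule ccontr)
  assume "\<not> ?thesis"
  then have neg: "a < 0 \<or> 0 < b" if "(a, b) \<in> P" for a b using that by force
  \<comment> \<open>The product encodes that \<open>f\<close> has the sign of \<open>t - s\<close>
    near a zero \<open>s\<close>. A piece in force near \<open>s\<close> vanishes at
    \<open>s\<close>; if it did not increase, it would satisfy \<open>0 \<le> a\<close> and
    \<open>b \<le> 0\<close>, which \<open>neg\<close> excludes.\<close>
  have cross: "\<forall>\<^sub>F t in at s within {0..1}. 0 < f t * (t - s)"
    if s: "s \<in> {0..1}" "f s = 0" for s
  proof -
    let ?l = "\<lambda>(a, b) t. (1 - t) * a + t * b"
    have "\<forall>\<^sub>F t in at s within {0..1}. \<exists>p\<in>?l ` P. f t = p t \<and> f s = p s"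
      using P pieces s
      by (intro eventually_common_piece f) (auto intro!: continuous_intros simp: split_beta)
    moreover have "\<forall>\<^sub>F t in at s within {0..1}. t \<noteq> s"
      by (simp add: eventually_at_filter)
    ultimately show ?thesis
    proof eventually_elim
      case (elim t)
      then obtain a b where ab: "(a, b) \<in> P" "f t = (1 - t) * a + t * b" "(1 - s) * a + s * b = 0"
        using s by auto
      have "a < b"
      proof (rule ccontr)
        assume "\<not> a < b"
        then have "(1 - s) * b \<le> (1 - s) * a" "s * b \<le> s * a"
          using s by (auto intro: mult_left_mono)
        then have "b \<le> 0" "0 \<le> a" using ab(3) by (auto simp: algebra_simps)
        then show False using neg[OF ab(1)] by auto
      qed
      moreover have "f t = (t - s) * (b - a)" using ab by (simp add: algebra_simps)
      ultimately show ?case using elim(2)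
        by (simp add: zero_less_mult_iff mult_less_0_iff) linarith
    qed
  qed
  obtain d where d: "d > 0" "\<And>t. \<lbrakk>t \<in> {0..1}; t \<noteq> 0; \<bar>t\<bar> < d\<rbrakk> \<Longrightarrow> 0 < f t * t"
    using cross[of 0] f by (auto simp: eventually_at dist_real_def)
  define t1 where "t1 = min (d / 2) (1 / 2)"
  have "0 < t1" "t1 < 1" "t1 < d" using d(1) by (auto simp: t1_def min_def)
  then have t1: "0 < t1" "t1 < 1" "0 < f t1"
    using d(2)[of t1] by (auto simp: zero_less_mult_iff)
  have f1: "continuous_on {t1..1} f" using t1 by (intro continuous_on_subset[OF f(1)]) auto
  \<comment> \<open>Right after 0 the function is positive, at \<open>t1\<close>. The least
    \<open>z\<close> beyond \<open>t1\<close> where it fails to be positive is a zero by the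
    intermediate value theorem, but crossing upwards at \<open>z\<close> would make \<open>f\<close>
    negative just before \<open>z\<close>, against minimality.\<close>
  define Z where "Z = {t \<in> {t1..1}. f t \<le> 0}"
  have "closed Z"
    unfolding Z_def using f1 by (intro continuous_on_closed_Collect_le) auto
  moreover have "bounded Z"
    by (rule bounded_subset[OF bounded_closed_interval[of t1 1]]) (auto simp: Z_def)
  ultimately have "compact Z" by (simp add: compact_eq_bounded_closed)
  moreover have "Z \<noteq> {}" using f t1 by (auto simp: Z_def)
  ultimately obtain z where z: "z \<in> Z" "\<And>t. t \<in> Z \<Longrightarrow> z \<le> t"
    using compact_attains_inf[of Z] by blast
  then have z1: "t1 \<le> z" "z \<le> 1" "f z \<le> 0" by (auto simp: Z_def)
  have "continuous_on {t1..z} f" using z1 by (intro continuous_on_subset[OF f1]) auto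
  then obtain w where w: "t1 \<le> w" "w \<le> z" "f w = 0"
    using IVT2'[of f z 0 t1] z1 t1 by auto
  then have "w \<in> Z" using z1 by (auto simp: Z_def)
  then have "f z = 0" using z(2) w by force
  obtain e where e: "e > 0" "\<And>t. \<lbrakk>t \<in> {0..1}; t \<noteq> z; \<bar>t - z\<bar> < e\<rbrakk> \<Longrightarrow> 0 < f t * (t - z)"
    using cross[of z] z1 t1 \<open>f z = 0\<close> by (auto simp: eventually_at dist_real_def)
  have "t1 < z" using z1 t1 \<open>f z = 0\<close> by (cases "t1 = z") auto
  \<comment> \<open>The maximum keeps \<open>t2\<close> both within \<open>e\<close> of
    \<open>z\<close> and beyond \<open>t1\<close>.\<close>
  define t2 where "t2 = max (z - e / 2) ((t1 + z) / 2)"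
  have "z - e / 2 \<le> t2" "(t1 + z) / 2 \<le> t2" "t2 < z"
    using e(1) \<open>t1 < z\<close> by (simp_all add: t2_def)
  then have t2: "t1 < t2" "t2 < z" "\<bar>t2 - z\<bar> < e"
    using e(1) \<open>t1 < z\<close> unfolding abs_less_iff by auto
  then have "f t2 < 0" using e(2)[of t2] t1 z1 by (auto simp: zero_less_mult_iff)
  then have "t2 \<in> Z" using t2 z1 by (auto simp: Z_def)
  then show False using z(2) t2 by force
qed

section \<open>Max-min representations in lattices of functions\<close>

lemma closed_under_Min:
  fixes T :: "('x \<Rightarrow> real) set"
  assumes "\<And>f g. \<lbrakk>f \<in> T; g \<in> T\<rbrakk> \<Longrightarrow> \<exists>h\<in>T. \<forall>x\<in>X. h x = min (f x) (g x)"
    and "finite S" "S \<noteq> {}" "S \<subseteq> T"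
  shows "\<exists>h\<in>T. \<forall>x\<in>X. h x = Min ((\<lambda>f. f x) ` S)"
  using assms(2-)
proof (induction S rule: finite_ne_induct)
  case (singleton f)
  then show ?case by auto
next
  case (insert f S)
  then obtain h where h: "h \<in> T" "\<forall>x\<in>X. h x = Min ((\<lambda>f. f x) ` S)" by auto
  obtain k where "k \<in> T" "\<forall>x\<in>X. k x = min (f x) (h x)"
    using assms(1)[of f h] insert h by auto
  then show ?case using insert h by (auto intro!: bexI[of _ k])
qed

lemma closed_under_Max:
  fixes T :: "('x \<Rightarrow> real) set"
  assumes "\<And>f g. \<lbrakk>f \<in> T; g \<in> T\<rbrakk> \<Longrightarrow> \<exists>h\<in>T. \<forall>x\<in>X. h x = max (f x) (g x)"
    and "finite S" "S \<noteq> {}" "S \<subseteq> T"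
  shows "\<exists>h\<in>T. \<forall>x\<in>X. h x = Max ((\<lambda>f. f x) ` S)"
  using assms(2-)
proof (induction S rule: finite_ne_induct)
  case (singleton f)
  then show ?case by auto
next
  case (insert f S)
  then obtain h where h: "h \<in> T" "\<forall>x\<in>X. h x = Max ((\<lambda>f. f x) ` S)" by auto
  obtain k where "k \<in> T" "\<forall>x\<in>X. k x = max (f x) (h x)"
    using assms(1)[of f h] insert h by auto
  then show ?case using insert h by (auto intro!: bexI[of _ k])
qed

text \<open>
  \<open>f\<close> is the maximum over \<open>x\<close> of the minima of those \<open>c \<in> C\<close> with \<open>c x \<ge> f x\<close>.
\<close>

lemma max_min_representation:
  fixes f :: "'x \<Rightarrow> real"
  assumes min: "\<And>f g. \<lbrakk>f \<in> T; g \<in> T\<rbrakk> \<Longrightarrow> \<exists>h\<in>T. \<forall>x\<in>X. h x = min (f x) (g x)"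
    and max: "\<And>f g. \<lbrakk>f \<in> T; g \<in> T\<rbrakk> \<Longrightarrow> \<exists>h\<in>T. \<forall>x\<in>X. h x = max (f x) (g x)"
    and C: "finite C" "C \<subseteq> T" and X: "X \<noteq> {}"
    and sep: "\<And>x y. \<lbrakk>x \<in> X; y \<in> X\<rbrakk> \<Longrightarrow> \<exists>c\<in>C. f x \<le> c x \<and> c y \<le> f y"
  shows "\<exists>h\<in>T. \<forall>x\<in>X. h x = f x"
proof -
  define S where "S x = {c \<in> C. f x \<le> c x}" for x
  have S: "finite (S x)" "S x \<subseteq> C" for x using C(1) by (auto simp: S_def)
  have "\<exists>h\<in>T. \<forall>y\<in>X. h y = Min ((\<lambda>c. c y) ` S x)" if x: "x \<in> X" for x
    using S[of x] C(2) sep[OF x x] by (intro closed_under_Min min) (auto simp: S_def)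
  \<comment> \<open>The minima are indexed by the subsets \<open>S x\<close> of \<open>C\<close>
    instead of the points \<open>x\<close>: there are only finitely many such subsets, so the outer
    maximum is finite even if \<open>X\<close> is infinite.\<close>
  then have "\<forall>U\<in>S ` X. \<exists>h\<in>T. \<forall>y\<in>X. h y = Min ((\<lambda>c. c y) ` U)" by blast
  then obtain m where m: "\<And>U. U \<in> S ` X \<Longrightarrow> m U \<in> T"
    "\<And>U y. \<lbrakk>U \<in> S ` X; y \<in> X\<rbrakk> \<Longrightarrow> m U y = Min ((\<lambda>c. c y) ` U)"
    by metis
  have "S ` X \<subseteq> Pow C" using S(2) by auto
  then have fin: "finite (S ` X)" using C(1) by (auto intro: finite_subset)
  then obtain h where h: "h \<in> T" "\<forall>y\<in>X. h y = Max ((\<lambda>g. g y) ` m ` S ` X)"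
    using closed_under_Max[of T X "m ` S ` X", OF max] m(1) X by blast
  have "Max ((\<lambda>g. g y) ` m ` S ` X) = f y" if y: "y \<in> X" for y
  proof (rule antisym)
    show "Max ((\<lambda>g. g y) ` m ` S ` X) \<le> f y"
    proof (rule Max.boundedI)
      fix a assume "a \<in> (\<lambda>g. g y) ` m ` S ` X"
      then obtain x where x: "x \<in> X" "a = m (S x) y" by auto
      obtain c where "c \<in> S x" "c y \<le> f y" using sep[OF x(1) y] by (auto simp: S_def)
      then have "Min ((\<lambda>c. c y) ` S x) \<le> f y"
        using S(1)[of x] by (meson Min_le finite_imageI imageI order_trans)
      then show "a \<le> f y" using x y m(2) by simp
    qed (use fin X in auto)
    have "f y \<le> Min ((\<lambda>c. c y) ` S y)"
      using S(1)[of y] sep[OF y y] by (subst Min_ge_iff) (auto simp: S_def)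
    also have "\<dots> = m (S y) y" using m(2) y by simp
    also have "\<dots> \<le> Max ((\<lambda>g. g y) ` m ` S ` X)"
      using fin y by (intro Max_ge) auto
    finally show "f y \<le> Max ((\<lambda>g. g y) ` m ` S ` X)" .
  qed
  then show ?thesis using h by auto
qed

lemma int_affine_convex:
  assumes "int_affine p"
  shows "p ((1 - t) *\<^sub>R x + t *\<^sub>R y) = (1 - t) * p x + t * p y"
proof -
  obtain a b where p: "\<And>x. p x = (\<Sum>i\<in>UNIV. of_int (a $ i) * x $ i) + of_int b"
    using assms unfolding int_affine_def by blast
  have "(\<Sum>i\<in>UNIV. of_int (a $ i) * ((1 - t) *\<^sub>R x + t *\<^sub>R y) $ i) =
    (1 - t) * (\<Sum>i\<in>UNIV. of_int (a $ i) * x $ i) + t * (\<Sum>i\<in>UNIV. of_int (a $ i) * y $ i)"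
    by (simp add: sum_distrib_left sum.distrib[symmetric] algebra_simps)
  then show ?thesis by (simp add: p algebra_simps)
qed

text \<open>Restrict \<open>f\<close> to the segment from \<open>x\<close> to \<open>y\<close> and
  subtract the chord between its end values. The difference \<open>g\<close> vanishes at both ends
  and is piecewise affine, and a descending piece of \<open>g\<close> comes from a piece of
  \<open>f\<close> as wanted.\<close>

lemma mcnaughton_separating_piece:
  fixes f :: "real^'n \<Rightarrow> real"
  assumes f: "continuous_on cube f" and P: "finite P" "\<And>p. p \<in> P \<Longrightarrow> int_affine p"
    "\<And>x. x \<in> cube \<Longrightarrow> \<exists>p\<in>P. f x = p x" and xy: "x \<in> cube" "y \<in> cube"
  shows "\<exists>p\<in>P. f x \<le> p x \<and> p y \<le> f y"
proof -
  define c where "c t = (1 - t) *\<^sub>R x + t *\<^sub>R y" for t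
  have c: "c t \<in> cube" if t: "t \<in> {0..1}" for t
  proof -
    have "(1 - t) * x $ i + t * y $ i \<le> (1 - t) * 1 + t * 1" for i
      using t xy by (intro add_mono mult_left_mono) (auto simp: cube_def)
    then show ?thesis using t xy by (auto simp: cube_def c_def)
  qed
  define g where "g t = f (c t) - ((1 - t) * f x + t * f y)" for t
  have "continuous_on {0..1} (\<lambda>t. f (c t))"
    by (rule continuous_on_compose2[OF f]) (use c in \<open>auto simp: c_def intro!: continuous_intros\<close>)
  then have "continuous_on {0..1} g" unfolding g_def by (intro continuous_intros)
  moreover have "g 0 = 0" "g 1 = 0" by (auto simp: g_def c_def)
  moreover have "\<exists>(a, b)\<in>(\<lambda>p. (p x - f x, p y - f y)) ` P. g t = (1 - t) * a + t * b"
    if t: "t \<in> {0..1}" for t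
  proof -
    obtain p where "p \<in> P" "f (c t) = p (c t)" using P(3) c[OF t] by blast
    then show ?thesis
      using int_affine_convex[OF P(2), of p t x y]
      by (auto simp: g_def c_def algebra_simps intro!: bexI[of _ p])
  qed
  ultimately have "\<exists>(a, b)\<in>(\<lambda>p. (p x - f x, p y - f y)) ` P. 0 \<le> a \<and> b \<le> 0"
    using P(1) by (intro exists_descending_piece[of g]) auto
  then show ?thesis by auto
qed

section \<open>The MV-subalgebra generated by the coordinates\<close>

text \<open>Once this set is known to contain every McNaughton function, its induction rule extends
  statements about homomorphisms from the coordinates to all of them.\<close>

inductive_set coordinate_generated :: "(real^'n \<Rightarrow> real) set" where
  coord: "restrict (\<lambda>x. x $ i) cube \<in> coordinate_generated"
| zero: "mv_zero McNaughton \<in> coordinate_generated"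
| neg: "f \<in> coordinate_generated \<Longrightarrow> mv_neg McNaughton f \<in> coordinate_generated"
| plus: "\<lbrakk>f \<in> coordinate_generated; g \<in> coordinate_generated\<rbrakk> \<Longrightarrow>
    mv_plus McNaughton f g \<in> coordinate_generated"

lemma McNaughton_simps [simp]:
  "carrier McNaughton = {f. mcnaughton_function f}"
  "mv_zero McNaughton = restrict (\<lambda>x. 0) cube"
  "mv_plus McNaughton f g = restrict (\<lambda>x. min 1 (f x + g x)) cube"
  "mv_neg McNaughton f = restrict (\<lambda>x. 1 - f x) cube"
  by (simp_all add: McNaughton_def)

lemma mcnaughton_range: "\<lbrakk>mcnaughton_function f; x \<in> cube\<rbrakk> \<Longrightarrow> 0 \<le> f x \<and> f x \<le> 1"
  by (auto simp: mcnaughton_function_def image_subset_iff)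

lemma mcnaughton_ext:
  assumes "mcnaughton_function f" "mcnaughton_function g" "\<And>x. x \<in> cube \<Longrightarrow> f x = g x"
  shows "f = g"
  using assms by (auto simp: mcnaughton_function_def intro: extensionalityI)

lemma mcnaughton_zero: "mcnaughton_function (restrict (\<lambda>x. 0) cube)"
  using mv_algebra.zero_closed[OF mv_algebra_McNaughton] by simp

lemma mcnaughton_neg:
  "mcnaughton_function f \<Longrightarrow> mcnaughton_function (restrict (\<lambda>x. 1 - f x) cube)"
  using mv_algebra.neg_closed[OF mv_algebra_McNaughton] by simp

lemma mcnaughton_plus:
  "\<lbrakk>mcnaughton_function f; mcnaughton_function g\<rbrakk> \<Longrightarrow>
    mcnaughton_function (restrict (\<lambda>x. min 1 (f x + g x)) cube)"
  using mv_algebra.plus_closed[OF mv_algebra_McNaughton] by simp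

lemma int_affine_coord: "int_affine (\<lambda>x::real^'n. of_int n * x $ i + of_int b)"
proof -
  have "(\<Sum>j\<in>UNIV. of_int ((\<chi> j. if j = i then n else 0) $ j) * x $ j) = of_int n * x $ i"
    for x :: "real^'n"
    by (simp add: if_distrib[of of_int] if_distrib[of "\<lambda>a. a * _"] cong: if_cong)
  then show ?thesis
    unfolding int_affine_def by (intro exI[of _ "\<chi> j. if j = i then n else 0"] exI[of _ b]) simp
qed

lemma mcnaughton_coord: "mcnaughton_function (restrict (\<lambda>x::real^'n. x $ i) cube)"
proof -
  have "int_affine (\<lambda>x::real^'n. x $ i)" using int_affine_coord[of 1 i 0] by simp
  moreover have "continuous_on cube (restrict (\<lambda>x::real^'n. x $ i) cube)"
    by (auto intro!: continuous_intros cong: continuous_on_cong)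
  ultimately show ?thesis
    unfolding mcnaughton_function_def
    by (intro conjI exI[of _ "{\<lambda>x. x $ i}"]) (auto simp: cube_def)
qed

lemma mcnaughton_coordinate_generated:
  "f \<in> coordinate_generated \<Longrightarrow> mcnaughton_function f"
proof (induction rule: coordinate_generated.induct)
  case (neg f)
  then show ?case unfolding McNaughton_simps by (intro mcnaughton_neg)
next
  case (plus f g)
  then show ?case unfolding McNaughton_simps by (intro mcnaughton_plus)
next
  case (coord i)
  show ?case by (rule mcnaughton_coord)
next
  case zero
  show ?case unfolding McNaughton_simps by (rule mcnaughton_zero)
qed

text \<open>Restricting here lets the closure properties below be stated for plain expressions,
  whatever their values off the cube.\<close>

definition generated_on_cube :: "(real^'n \<Rightarrow> real) \<Rightarrow> bool" where
  "generated_on_cube f \<longleftrightarrow> restrict f cube \<in> coordinate_generated"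

lemma generated_on_cube_cong:
  "\<lbrakk>generated_on_cube f; \<And>x. x \<in> cube \<Longrightarrow> f x = g x\<rbrakk> \<Longrightarrow> generated_on_cube g"
  unfolding generated_on_cube_def using restrict_ext[of cube f g] by simp

lemma generated_neg: "generated_on_cube f \<Longrightarrow> generated_on_cube (\<lambda>x. 1 - f x)"
  unfolding generated_on_cube_def
  by (drule coordinate_generated.neg) (simp cong: restrict_cong)

lemma generated_plus:
  "\<lbrakk>generated_on_cube f; generated_on_cube g\<rbrakk> \<Longrightarrow> generated_on_cube (\<lambda>x. min 1 (f x + g x))"
  unfolding generated_on_cube_def
  by (drule (1) coordinate_generated.plus) (simp cong: restrict_cong)

lemma generated_coord: "generated_on_cube (\<lambda>x. x $ i)"
  unfolding generated_on_cube_def by (rule coordinate_generated.coord)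

lemma generated_zero: "generated_on_cube (\<lambda>x. 0)"
  using coordinate_generated.zero by (simp add: generated_on_cube_def)

lemma generated_range: "\<lbrakk>generated_on_cube f; x \<in> cube\<rbrakk> \<Longrightarrow> 0 \<le> f x \<and> f x \<le> 1"
  using mcnaughton_range[OF mcnaughton_coordinate_generated, of "restrict f cube" x]
  by (simp add: generated_on_cube_def)

text \<open>The join in an MV-algebra is the term
  \<open>\<not> (\<not> f \<oplus> g) \<oplus> g\<close>.\<close>

lemma generated_max:
  assumes "generated_on_cube f" "generated_on_cube g"
  shows "generated_on_cube (\<lambda>x. max (f x) (g x))"
proof (rule generated_on_cube_cong)
  show "generated_on_cube (\<lambda>x. min 1 ((1 - min 1 ((1 - f x) + g x)) + g x))"
    using assms by (intro generated_plus generated_neg)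
  show "min 1 ((1 - min 1 ((1 - f x) + g x)) + g x) = max (f x) (g x)" if "x \<in> cube" for x
    using assms[THEN generated_range, OF that] by (auto simp: min_def max_def)
qed

lemma generated_min:
  assumes "generated_on_cube f" "generated_on_cube g"
  shows "generated_on_cube (\<lambda>x. min (f x) (g x))"
proof (rule generated_on_cube_cong)
  show "generated_on_cube (\<lambda>x. 1 - max (1 - f x) (1 - g x))"
    using assms by (intro generated_max generated_neg)
qed (auto simp: min_def max_def)

section \<open>Truncated integer affine functions are generated by the coordinates\<close>

definition clip :: "real \<Rightarrow> real" where
  "clip a = max 0 (min 1 a)"

lemma clip_neg: "clip (1 - a) = 1 - clip a"
  by (auto simp: clip_def min_def max_def)

text \<open>
  In terms of the MV-operations: \<open>clip (a + x) = (clip a \<oplus> x) \<odot> clip (a + 1)\<close>, where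
  \<open>y \<odot> z = \<not> (\<not> y \<oplus> \<not> z)\<close>.
\<close>

lemma clip_add:
  assumes "0 \<le> x" "x \<le> 1"
  shows "clip (a + x) = 1 - min 1 ((1 - min 1 (clip a + x)) + (1 - clip (a + 1)))"
proof -
  \<comment> \<open>The cuts are where \<open>clip (a + 1)\<close> leaves 0 and where it reaches 1;
    at the second one \<open>clip a\<close> leaves 0.\<close>
  consider "a \<le> - 1" | "- 1 < a" "a \<le> 0" | "0 < a" by linarith
  then show ?thesis using assms by cases (simp_all add: clip_def min_def max_def)
qed

text \<open>All integer shifts are taken together because adding a coordinate at shift
  \<open>b\<close> by \<open>clip_add\<close> uses the truncations at shifts \<open>b\<close> and
  \<open>b + 1\<close>.\<close>

definition clip_generated :: "(real^'n \<Rightarrow> real) \<Rightarrow> bool" where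
  "clip_generated f \<longleftrightarrow> (\<forall>b::int. generated_on_cube (\<lambda>x. clip (f x + of_int b)))"

lemma clip_generated_coord_add:
  fixes f :: "real^'n \<Rightarrow> real" and i :: 'n
  assumes "clip_generated f"
  shows "clip_generated (\<lambda>x. f x + x $ i)"
  unfolding clip_generated_def
proof
  fix b :: int
  have *: "generated_on_cube (\<lambda>x. clip (f x + of_int b))"
    "generated_on_cube (\<lambda>x. clip (f x + of_int (b + 1)))"
    using assms unfolding clip_generated_def by blast+
  have "generated_on_cube (\<lambda>x. 1 - min 1 ((1 - min 1 (clip (f x + of_int b) + x $ i)) +
      (1 - clip (f x + of_int (b + 1)))))"
    by (intro generated_plus generated_neg generated_coord *)
  then show "generated_on_cube (\<lambda>x. clip (f x + x $ i + of_int b))"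
  proof (rule generated_on_cube_cong)
    fix x :: "real^'n" assume "x \<in> cube"
    then have "0 \<le> x $ i" "x $ i \<le> 1" by (auto simp: cube_def)
    from clip_add[OF this, of "f x + of_int b"]
    show "1 - min 1 ((1 - min 1 (clip (f x + of_int b) + x $ i)) +
      (1 - clip (f x + of_int (b + 1)))) = clip (f x + x $ i + of_int b)"
      by (simp add: add_ac)
  qed
qed

lemma clip_generated_neg:
  assumes "clip_generated f"
  shows "clip_generated (\<lambda>x. - f x)"
  unfolding clip_generated_def
proof
  fix b :: int
  have "generated_on_cube (\<lambda>x. 1 - clip (f x + of_int (1 - b)))"
    using assms unfolding clip_generated_def by (intro generated_neg) blast
  then show "generated_on_cube (\<lambda>x. clip (- f x + of_int b))"
    by (rule generated_on_cube_cong) (simp add: clip_neg[symmetric] algebra_simps)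
qed

lemma clip_generated_coord_diff:
  fixes f :: "real^'n \<Rightarrow> real" and i :: 'n
  assumes "clip_generated f"
  shows "clip_generated (\<lambda>x. f x - x $ i)"
  using clip_generated_neg[OF clip_generated_coord_add[OF clip_generated_neg[OF assms]], of i]
  by simp

lemma clip_generated_multiple_add:
  fixes f :: "real^'n \<Rightarrow> real" and i :: 'n
  assumes "clip_generated f"
  shows "clip_generated (\<lambda>x. f x + of_int k * x $ i)"
proof (induction k rule: int_induct[where k = 0])
  case base
  then show ?case using assms by simp
next
  case (step1 k)
  then show ?case using clip_generated_coord_add[OF step1(2), of i] by (simp add: algebra_simps)
next
  case (step2 k)
  then show ?case using clip_generated_coord_diff[OF step2(2), of i] by (simp add: algebra_simps)
qed

text \<open>The linear part is built up one coordinate at a time, with an inner induction on each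
  integer coefficient. It starts from truncated integer constants, which are 0 or 1.\<close>

lemma clip_generated_int_affine:
  fixes p :: "real^'n \<Rightarrow> real"
  assumes "int_affine p"
  shows "generated_on_cube (\<lambda>x. clip (p x))"
proof -
  obtain a b where p: "\<And>x. p x = (\<Sum>i\<in>UNIV. of_int (a $ i) * x $ i) + of_int b"
    using assms unfolding int_affine_def by blast
  have "clip_generated (\<lambda>x. \<Sum>i\<in>I. of_int (a $ i) * x $ i)" if "finite I" for I
    using that
  proof (induction I)
    case empty
    have "generated_on_cube (\<lambda>x::real^'n. clip (of_int b))" for b :: int
    proof (cases "b \<le> 0")
      case True
      show ?thesis
        by (rule generated_on_cube_cong[OF generated_zero]) (use True in \<open>simp add: clip_def\<close>)
    next
      case False
      show ?thesis
        by (rule generated_on_cube_cong[OF generated_neg[OF generated_zero]])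
          (use False in \<open>simp add: clip_def\<close>)
    qed
    then show ?case by (simp add: clip_generated_def)
  next
    case (insert i I)
    then show ?case using clip_generated_multiple_add[OF insert(3), of "a $ i" i]
      by (simp add: add.commute)
  qed
  then show ?thesis unfolding p clip_generated_def by simp
qed

text \<open>Since \<open>f\<close> takes values in the unit interval, truncating its pieces
  preserves both separating inequalities, so \<open>f\<close> is a max-min combination of truncated
  pieces.\<close>

lemma coordinate_generated_McNaughton:
  assumes "mcnaughton_function (f :: real^'n \<Rightarrow> real)"
  shows "f \<in> coordinate_generated"
proof -
  obtain P where P: "finite P" "\<And>p. p \<in> P \<Longrightarrow> int_affine p" "\<And>x. x \<in> cube \<Longrightarrow> \<exists>p\<in>P. f x = p x"
    and f: "continuous_on cube f" using assms by (auto simp: mcnaughton_function_def)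
  have "\<exists>h\<in>Collect generated_on_cube. \<forall>x\<in>cube. h x = f x"
  proof (rule max_min_representation)
    show "finite ((\<lambda>p x. clip (p x)) ` P)" using P by simp
    show "(\<lambda>p x. clip (p x)) ` P \<subseteq> Collect generated_on_cube"
      using P clip_generated_int_affine by auto
  next
    have "(0 :: real^'n) \<in> cube" by (simp add: cube_def)
    then show "cube \<noteq> ({} :: (real^'n) set)" by blast
    fix x y :: "real^'n" assume xy: "x \<in> cube" "y \<in> cube"
    then obtain p where "p \<in> P" "f x \<le> p x" "p y \<le> f y"
      using mcnaughton_separating_piece[OF f P] by blast
    then show "\<exists>c\<in>(\<lambda>p x. clip (p x)) ` P. f x \<le> c x \<and> c y \<le> f y"
      using mcnaughton_range[OF assms xy(1)] mcnaughton_range[OF assms xy(2)]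
      by (intro bexI[of _ "\<lambda>x. clip (p x)"]) (auto simp: clip_def)
  next
    fix f g :: "real^'n \<Rightarrow> real"
    assume fg: "f \<in> Collect generated_on_cube" "g \<in> Collect generated_on_cube"
    show "\<exists>h\<in>Collect generated_on_cube. \<forall>x\<in>cube. h x = min (f x) (g x)"
      using fg by (intro bexI[of _ "\<lambda>x. min (f x) (g x)"]) (simp_all add: generated_min)
    show "\<exists>h\<in>Collect generated_on_cube. \<forall>x\<in>cube. h x = max (f x) (g x)"
      using fg by (intro bexI[of _ "\<lambda>x. max (f x) (g x)"]) (simp_all add: generated_max)
  qed
  then obtain h where h: "restrict h cube \<in> coordinate_generated" "\<forall>x\<in>cube. h x = f x"
    by (auto simp: generated_on_cube_def)
  moreover have "restrict h cube = f"
    using h mcnaughton_coordinate_generated[OF h(1)] assms by (intro mcnaughton_ext) auto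
  ultimately show ?thesis by simp
qed

section \<open>Germinal unital l-groups\<close>

text \<open>A rational number strictly between \<open>s\<close> and \<open>t\<close>, with its
  denominator cleared, gives an integer affine function changing sign there; a change of sign of the
  slope covers \<open>t < s\<close>.\<close>

lemma integer_separation:
  fixes s t :: real
  assumes "s \<noteq> t"
  shows "\<exists>n b :: int. of_int n * s + of_int b < 0 \<and> 0 < of_int n * t + of_int b"
proof -
  have *: "\<exists>n b :: int. of_int n * s + of_int b < 0 \<and> 0 < of_int n * t + of_int b"
    if st: "s < t" for s t :: real
  proof -
    obtain r where "r \<in> \<rat>" and r: "s < r" "r < t" using Rats_dense_in_real st by blast
    then obtain p q :: int where q: "q > 0" "r = of_int p / of_int q"
      by (meson Rats_cases')
    then have "of_int q * s + of_int (- p) < 0" "0 < of_int q * t + of_int (- p)"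
      using r by (simp_all add: pos_less_divide_eq pos_divide_less_eq mult.commute)
    then show ?thesis by blast
  qed
  consider "s < t" | "- s < - t" using assms by linarith
  then show ?thesis
  proof cases
    case 2
    then obtain n b :: int where "of_int n * - s + of_int b < 0" "0 < of_int n * - t + of_int b"
      using * by blast
    then show ?thesis by (intro exI[of _ "- n"] exI[of _ b]) simp
  qed (rule *)
qed

section \<open>Germs and the quotient MV-algebra\<close>

definition germ_eq :: "real^'n \<Rightarrow> (real^'n \<Rightarrow> real) \<Rightarrow> (real^'n \<Rightarrow> real) \<Rightarrow> bool" where
  "germ_eq w f g \<longleftrightarrow> (\<forall>\<^sub>F x in nhds w. x \<in> cube \<longrightarrow> f x = g x)"

lemma germ_eq_refl: "germ_eq w f f"
  by (simp add: germ_eq_def)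

lemma germ_eq_sym: "germ_eq w f g \<Longrightarrow> germ_eq w g f"
  unfolding germ_eq_def by (erule eventually_mono) simp

lemma germ_eq_trans: "\<lbrakk>germ_eq w f g; germ_eq w g k\<rbrakk> \<Longrightarrow> germ_eq w f k"
  unfolding germ_eq_def by (erule (1) eventually_elim2) simp

lemma germ_eq_neg:
  "germ_eq w f g \<Longrightarrow> germ_eq w (mv_neg McNaughton f) (mv_neg McNaughton g)"
  unfolding germ_eq_def by (erule eventually_mono) simp

lemma germ_eq_plus:
  "\<lbrakk>germ_eq w f f'; germ_eq w g g'\<rbrakk> \<Longrightarrow>
    germ_eq w (mv_plus McNaughton f g) (mv_plus McNaughton f' g')"
  unfolding germ_eq_def by (erule (1) eventually_elim2) simp

abbreviation germ :: "real^'n \<Rightarrow> (real^'n \<Rightarrow> real) \<Rightarrow> (real^'n \<Rightarrow> real) set" where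
  "germ w \<equiv> mv_class McNaughton (germ_ideal w)"

abbreviation germ_algebra :: "real^'n \<Rightarrow> (real^'n \<Rightarrow> real) set mv" where
  "germ_algebra w \<equiv> mv_quotient McNaughton (germ_ideal w)"

text \<open>For values in the unit interval the Chang distance is zero exactly at points of
  agreement, so it belongs to the germ ideal iff the functions agree near \<open>w\<close>.\<close>

lemma germ_alt:
  assumes f: "mcnaughton_function f"
  shows "germ w f = {g. mcnaughton_function g \<and> germ_eq w f g}"
proof -
  have "mv_plus McNaughton (mv_minus McNaughton f g) (mv_minus McNaughton g f) \<in> germ_ideal w
      \<longleftrightarrow> germ_eq w f g" if g: "mcnaughton_function g" for g
  proof -
    let ?d = "mv_plus McNaughton (mv_minus McNaughton f g) (mv_minus McNaughton g f)"
    interpret mv_algebra "McNaughton :: (real^'n \<Rightarrow> real) mv" by (rule mv_algebra_McNaughton)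
    have "?d \<in> carrier McNaughton"
      unfolding mv_minus_def using f g by (intro plus_closed neg_closed) simp_all
    moreover have "?d x = 0 \<longleftrightarrow> f x = g x" if x: "x \<in> cube" for x
      using mcnaughton_range[OF f x] mcnaughton_range[OF g x] x
      by (simp add: mv_minus_def min_def)
    ultimately show ?thesis
      by (auto simp: germ_ideal_def germ_eq_def eventually_nhds simp del: McNaughton_simps)
  qed
  then show ?thesis unfolding mv_class_def by (simp del: McNaughton_simps(2-)) blast
qed

lemma germ_self: "mcnaughton_function f \<Longrightarrow> f \<in> germ w f"
  by (simp add: germ_alt germ_eq_refl)

lemma germ_eq_iff:
  assumes "mcnaughton_function f" "mcnaughton_function g"
  shows "germ w f = germ w g \<longleftrightarrow> germ_eq w f g"
  using assms by (auto simp: germ_alt intro: germ_eq_refl germ_eq_sym germ_eq_trans)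

text \<open>The quotient operation is a union over representatives. All of them yield the same
  class, so this is a constant union over a nonempty set; addition works likewise.\<close>

lemma germ_algebra_neg:
  assumes f: "mcnaughton_function f"
  shows "mv_neg (germ_algebra w) (germ w f) = germ w (mv_neg McNaughton f)"
proof -
  have "germ w (mv_neg McNaughton g) = germ w (mv_neg McNaughton f)" if "g \<in> germ w f" for g
    using that germ_eq_neg[of w f g] f mcnaughton_neg[of f] mcnaughton_neg[of g]
    by (subst germ_eq_iff) (auto simp: germ_alt intro: germ_eq_sym)
  then have "(\<Union>g\<in>germ w f. germ w (mv_neg McNaughton g)) =
      (\<Union>g\<in>germ w f. germ w (mv_neg McNaughton f))"
    by (intro SUP_cong refl)
  also have "\<dots> = germ w (mv_neg McNaughton f)"
    using germ_self[OF f] by (simp only: UN_constant split: if_split) blast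
  finally show ?thesis by (simp add: mv_quotient_def)
qed

lemma germ_algebra_plus:
  assumes f: "mcnaughton_function f" and g: "mcnaughton_function g"
  shows "mv_plus (germ_algebra w) (germ w f) (germ w g) = germ w (mv_plus McNaughton f g)"
proof -
  have "germ w (mv_plus McNaughton f' g') = germ w (mv_plus McNaughton f g)"
    if "f' \<in> germ w f" "g' \<in> germ w g" for f' g'
    using that germ_eq_plus[of w f f' g g'] f g mcnaughton_plus[of f g] mcnaughton_plus[of f' g']
    by (subst germ_eq_iff) (auto simp: germ_alt intro: germ_eq_sym)
  then have "(\<Union>f'\<in>germ w f. \<Union>g'\<in>germ w g. germ w (mv_plus McNaughton f' g')) =
      (\<Union>f'\<in>germ w f. \<Union>g'\<in>germ w g. germ w (mv_plus McNaughton f g))"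
    by (intro SUP_cong refl)
  also have "\<dots> = germ w (mv_plus McNaughton f g)"
    using germ_self[OF f] germ_self[OF g] by (simp only: UN_constant empty_iff if_False split: if_split) blast
  finally show ?thesis by (simp add: mv_quotient_def)
qed

section \<open>The unit interval and its presentation by McNaughton functions\<close>

lemma (in unital_lgroup) Gamma_closed:
  "mv_zero (Gamma G) \<in> carrier (Gamma G)"
  "x \<in> carrier (Gamma G) \<Longrightarrow> mv_neg (Gamma G) x \<in> carrier (Gamma G)"
  "\<lbrakk>x \<in> carrier (Gamma G); y \<in> carrier (Gamma G)\<rbrakk> \<Longrightarrow> mv_plus (Gamma G) x y \<in> carrier (Gamma G)"
proof -
  show "mv_zero (Gamma G) \<in> carrier (Gamma G)"
    using unit_nonneg le_refl by (simp add: Gamma_def)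
  show "mv_neg (Gamma G) x \<in> carrier (Gamma G)" if "x \<in> carrier (Gamma G)"
  proof -
    have x: "x \<in> carrier G" "\<one> \<preceq> x" "x \<preceq> order_unit G" using that by (simp_all add: Gamma_def)
    have "\<one> \<preceq> order_unit G \<otimes> inv x"
      using le_mult_iff[of \<one> "order_unit G" "inv x"] x unit_closed by simp
    moreover have "order_unit G \<otimes> inv x \<preceq> order_unit G"
      using le_mult_iff[of "order_unit G" "order_unit G" x] le_mult_right x unit_closed by simp
    ultimately show ?thesis using x unit_closed by (simp add: Gamma_def)
  qed
  show "mv_plus (Gamma G) x y \<in> carrier (Gamma G)"
    if "x \<in> carrier (Gamma G)" "y \<in> carrier (Gamma G)"
    using that unit_closed unit_nonneg
    by (simp add: Gamma_def lmeet_closed lmeet_left lmeet_greatest one_le_mult)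
qed

text \<open>Here \<open>\<gamma>\<close> is the class map followed by the inverse of the given
  isomorphism. It replaces cosets by McNaughton functions, two of which are identified iff they have
  the same germ at \<open>w\<close>.\<close>

lemma germinal_presentation:
  fixes w :: "real^'n"
  assumes "germinal_ulgroup G w"
  obtains \<gamma> where
    "\<And>f. mcnaughton_function f \<Longrightarrow> \<gamma> f \<in> carrier (Gamma G)"
    "\<And>z. z \<in> carrier (Gamma G) \<Longrightarrow> \<exists>f. mcnaughton_function f \<and> \<gamma> f = z"
    "\<And>f g. \<lbrakk>mcnaughton_function f; mcnaughton_function g\<rbrakk> \<Longrightarrow> \<gamma> f = \<gamma> g \<longleftrightarrow> germ_eq w f g"
    "\<gamma> (mv_zero McNaughton) = mv_zero (Gamma G)"
    "\<And>f. mcnaughton_function f \<Longrightarrow> \<gamma> (mv_neg McNaughton f) = mv_neg (Gamma G) (\<gamma> f)"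
    "\<And>f g. \<lbrakk>mcnaughton_function f; mcnaughton_function g\<rbrakk> \<Longrightarrow>
      \<gamma> (mv_plus McNaughton f g) = mv_plus (Gamma G) (\<gamma> f) (\<gamma> g)"
proof -
  interpret unital_lgroup G using assms by (simp add: germinal_ulgroup_def)
  obtain \<theta> where \<theta>: "bij_betw \<theta> (carrier (Gamma G)) (carrier (germ_algebra w))"
    "\<theta> (mv_zero (Gamma G)) = mv_zero (germ_algebra w)"
    "\<And>x. x \<in> carrier (Gamma G) \<Longrightarrow> \<theta> (mv_neg (Gamma G) x) = mv_neg (germ_algebra w) (\<theta> x)"
    "\<And>x y. \<lbrakk>x \<in> carrier (Gamma G); y \<in> carrier (Gamma G)\<rbrakk> \<Longrightarrow>
      \<theta> (mv_plus (Gamma G) x y) = mv_plus (germ_algebra w) (\<theta> x) (\<theta> y)"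
    using assms unfolding germinal_ulgroup_def mv_iso_def by blast
  have car: "carrier (germ_algebra w) = germ w ` Collect mcnaughton_function"
    by (simp add: mv_quotient_def)
  define \<gamma> where "\<gamma> f = inv_into (carrier (Gamma G)) \<theta> (germ w f)" for f
  have \<gamma>: "\<gamma> f \<in> carrier (Gamma G)" "\<theta> (\<gamma> f) = germ w f" if "mcnaughton_function f" for f
  proof -
    have *: "germ w f \<in> \<theta> ` carrier (Gamma G)"
      using \<theta>(1) that unfolding bij_betw_def car by blast
    show "\<gamma> f \<in> carrier (Gamma G)" unfolding \<gamma>_def by (rule inv_into_into[OF *])
    show "\<theta> (\<gamma> f) = germ w f" unfolding \<gamma>_def by (rule f_inv_into_f[OF *])
  qed
  have \<gamma>_eqI: "\<gamma> f = z" if "\<theta> z = germ w f" "z \<in> carrier (Gamma G)" for f z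
    using that \<theta>(1) unfolding \<gamma>_def by (metis bij_betw_def inv_into_f_f)
  show ?thesis
  proof (rule that[of \<gamma>])
    fix z assume z: "z \<in> carrier (Gamma G)"
    then have "\<theta> z \<in> carrier (germ_algebra w)" using \<theta>(1) by (auto simp: bij_betw_def)
    then show "\<exists>f. mcnaughton_function f \<and> \<gamma> f = z" using \<gamma>_eqI z by (auto simp: car)
  next
    fix f g :: "real^'n \<Rightarrow> real" assume fg: "mcnaughton_function f" "mcnaughton_function g"
    have "germ w f = germ w g" if "\<gamma> f = \<gamma> g"
      using \<gamma>(2)[OF fg(1)] \<gamma>(2)[OF fg(2)] that by simp
    then have "\<gamma> f = \<gamma> g \<longleftrightarrow> germ w f = germ w g" by (auto simp only: \<gamma>_def)
    then show "\<gamma> f = \<gamma> g \<longleftrightarrow> germ_eq w f g" by (simp only: germ_eq_iff[OF fg])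
    show "\<gamma> (mv_plus McNaughton f g) = mv_plus (Gamma G) (\<gamma> f) (\<gamma> g)"
      by (intro \<gamma>_eqI Gamma_closed) (simp_all only: \<theta>(4) \<gamma> fg germ_algebra_plus)
  next
    fix f :: "real^'n \<Rightarrow> real" assume f: "mcnaughton_function f"
    then show "\<gamma> f \<in> carrier (Gamma G)" by (rule \<gamma>)
    show "\<gamma> (mv_neg McNaughton f) = mv_neg (Gamma G) (\<gamma> f)"
      by (intro \<gamma>_eqI Gamma_closed) (simp_all only: \<theta>(3) \<gamma> f germ_algebra_neg)
  next
    show "\<gamma> (mv_zero McNaughton) = mv_zero (Gamma G)"
      using \<theta>(2) by (intro \<gamma>_eqI Gamma_closed) (simp add: mv_quotient_def)
  qed
qed

lemma ul_hom_Gamma: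
  assumes G: "unital_lgroup G" and h: "h \<in> ul_hom G G"
  shows "h (mv_zero (Gamma G)) = mv_zero (Gamma G)"
    and "x \<in> carrier (Gamma G) \<Longrightarrow> h x \<in> carrier (Gamma G)"
    and "x \<in> carrier (Gamma G) \<Longrightarrow> h (mv_neg (Gamma G) x) = mv_neg (Gamma G) (h x)"
    and "\<lbrakk>x \<in> carrier (Gamma G); y \<in> carrier (Gamma G)\<rbrakk> \<Longrightarrow>
      h (mv_plus (Gamma G) x y) = mv_plus (Gamma G) (h x) (h y)"
proof -
  interpret unital_lgroup G by fact
  interpret h: group_hom G G h by unfold_locales (rule ul_hom_hom[OF h])
  have u: "h (order_unit G) = order_unit G"
    and meet: "\<And>x y. \<lbrakk>x \<in> carrier G; y \<in> carrier G\<rbrakk> \<Longrightarrow> h (lmeet G x y) = lmeet G (h x) (h y)"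
    using h by (auto simp: ul_hom_def)
  note mono = ul_hom_mono[OF G G h]
  show "h (mv_zero (Gamma G)) = mv_zero (Gamma G)" by (simp add: Gamma_def)
  show "h x \<in> carrier (Gamma G)" if "x \<in> carrier (Gamma G)"
    using that mono[of "\<one>\<^bsub>G\<^esub>" x] mono[of x "order_unit G"] unit_closed u by (simp add: Gamma_def)
  show "h (mv_neg (Gamma G) x) = mv_neg (Gamma G) (h x)" if "x \<in> carrier (Gamma G)"
    using that unit_closed u by (simp add: Gamma_def)
  show "h (mv_plus (Gamma G) x y) = mv_plus (Gamma G) (h x) (h y)"
    if "x \<in> carrier (Gamma G)" "y \<in> carrier (Gamma G)"
    using that unit_closed u by (simp add: Gamma_def meet)
qed

text \<open>Any preimage \<open>y\<close> of \<open>v\<close> may be truncated to the unit interval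
  by a join with \<open>\<one>\<close> and a meet with the unit: \<open>h\<close> preserves both,
  and they fix \<open>v\<close>.\<close>

lemma ul_hom_Gamma_onto:
  assumes G: "unital_lgroup G" and h: "h \<in> ul_hom G G" "h ` carrier G = carrier G"
    and v: "v \<in> carrier (Gamma G)"
  shows "\<exists>z\<in>carrier (Gamma G). h z = v"
proof -
  interpret unital_lgroup G by fact
  interpret h: group_hom G G h by unfold_locales (rule ul_hom_hom[OF h(1)])
  have v': "v \<in> carrier G" "\<one>\<^bsub>G\<^esub> \<preceq>\<^bsub>G\<^esub> v" "v \<preceq>\<^bsub>G\<^esub> order_unit G" using v by (auto simp: Gamma_def)
  then have "v \<in> h ` carrier G" by (simp only: h(2))
  then obtain y where y: "y \<in> carrier G" "h y = v" by blast
  let ?j = "ljoin G \<one>\<^bsub>G\<^esub> y"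
  have j: "?j \<in> carrier G" "\<one>\<^bsub>G\<^esub> \<preceq>\<^bsub>G\<^esub> ?j" using ljoin_closed ljoin_left y by simp_all
  have "h (lmeet G ?j (order_unit G)) = lmeet G (ljoin G \<one>\<^bsub>G\<^esub> v) (order_unit G)"
    using h(1) y j unit_closed by (simp add: ul_hom_def)
  also have "\<dots> = v" using v' unit_closed by (simp add: ljoin_absorb lmeet_absorb1)
  finally have "h (lmeet G ?j (order_unit G)) = v" .
  moreover have "lmeet G ?j (order_unit G) \<in> carrier (Gamma G)"
    using j unit_closed unit_nonneg
    by (simp add: Gamma_def lmeet_closed lmeet_right lmeet_greatest)
  ultimately show ?thesis by blast
qed

text \<open>For \<open>y\<close> in the kernel of \<open>h\<close>, the meet of its positive part
  with the unit lies in the unit interval and in the kernel, so it is neutral. Hence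
  \<open>y\<close> is disjoint from the unit, which forces \<open>y \<preceq> \<one>\<close>; the
  inverse of \<open>x\<close> is treated alike.\<close>

lemma hopfianI_Gamma:
  assumes G: "unital_lgroup G"
    and ker: "\<And>h z. \<lbrakk>h \<in> ul_hom G G; h ` carrier G = carrier G; z \<in> carrier (Gamma G); h z = \<one>\<^bsub>G\<^esub>\<rbrakk>
      \<Longrightarrow> z = \<one>\<^bsub>G\<^esub>"
  shows "hopfian G"
proof (rule hopfianI[OF G])
  interpret unital_lgroup G by fact
  fix h x
  assume h: "h \<in> ul_hom G G" "h ` carrier G = carrier G" and x: "x \<in> carrier G" "h x = \<one>\<^bsub>G\<^esub>"
  interpret h: group_hom G G h by unfold_locales (rule ul_hom_hom[OF h(1)])
  have le: "y \<preceq>\<^bsub>G\<^esub> \<one>\<^bsub>G\<^esub>" if y: "y \<in> carrier G" "h y = \<one>\<^bsub>G\<^esub>" for y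
  proof (rule le_one_of_ldisjoint_unit)
    let ?j = "ljoin G y \<one>\<^bsub>G\<^esub>"
    have j: "?j \<in> carrier G" "\<one>\<^bsub>G\<^esub> \<preceq>\<^bsub>G\<^esub> ?j" "y \<preceq>\<^bsub>G\<^esub> ?j"
      using ljoin_closed ljoin_left ljoin_right y by simp_all
    have "h (lmeet G ?j (order_unit G)) = lmeet G (ljoin G \<one>\<^bsub>G\<^esub> \<one>\<^bsub>G\<^esub>) (order_unit G)"
      using h(1) y j unit_closed by (simp add: ul_hom_def)
    also have "\<dots> = \<one>\<^bsub>G\<^esub>"
      using unit_closed unit_nonneg by (simp add: ljoin_absorb lmeet_absorb1 le_refl)
    finally have "h (lmeet G ?j (order_unit G)) = \<one>\<^bsub>G\<^esub>" .
    moreover have "lmeet G ?j (order_unit G) \<in> carrier (Gamma G)"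
      using j unit_closed unit_nonneg
      by (simp add: Gamma_def lmeet_closed lmeet_right lmeet_greatest)
    ultimately have eq: "lmeet G ?j (order_unit G) = \<one>\<^bsub>G\<^esub>" using ker[OF h] by blast
    show "ldisjoint y (order_unit G)"
      unfolding ldisjoint_def
    proof safe
      fix t assume t: "t \<in> carrier G" "t \<preceq>\<^bsub>G\<^esub> y" "t \<preceq>\<^bsub>G\<^esub> order_unit G"
      then have "t \<preceq>\<^bsub>G\<^esub> ?j" using y j by (intro le_trans[OF t(2) j(3)])
      then show "t \<preceq>\<^bsub>G\<^esub> \<one>\<^bsub>G\<^esub>"
        using lmeet_greatest[of t ?j "order_unit G"] t j unit_closed by (simp add: eq)
    qed
  qed (rule y)
  have "inv\<^bsub>G\<^esub> x \<preceq>\<^bsub>G\<^esub> \<one>\<^bsub>G\<^esub>" using le[of "inv\<^bsub>G\<^esub> x"] x by simp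
  then have "\<one>\<^bsub>G\<^esub> \<preceq>\<^bsub>G\<^esub> x" using inv_le_iff[of x "\<one>\<^bsub>G\<^esub>"] x by simp
  then show "x = \<one>\<^bsub>G\<^esub>" using le[of x] x le_antisym by simp
qed

section \<open>Surjective endomorphisms in the germinal case\<close>

text \<open>Truncate an integer affine function of one coordinate that is negative at
  \<open>w\<close>, hence near \<open>w\<close>, and positive at \<open>z\<close>.\<close>

lemma mcnaughton_vanishing_near:
  fixes w z :: "real^'n"
  assumes "w \<noteq> z" "z \<in> cube"
  shows "\<exists>f. mcnaughton_function f \<and> germ_eq w f (mv_zero McNaughton) \<and> f z \<noteq> 0"
proof -
  obtain i where "w $ i \<noteq> z $ i" using assms by (auto simp: vec_eq_iff)
  then obtain n b :: int where nb: "of_int n * w $ i + of_int b < 0" "0 < of_int n * z $ i + of_int b"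
    using integer_separation by blast
  let ?p = "\<lambda>x::real^'n. of_int n * x $ i + of_int b"
  let ?f = "restrict (\<lambda>x. clip (?p x)) cube"
  have "mcnaughton_function ?f"
    using clip_generated_int_affine[OF int_affine_coord, of n i b] mcnaughton_coordinate_generated
    by (simp only: generated_on_cube_def)
  moreover have "open {x. ?p x < 0}" by (intro open_Collect_less continuous_intros)
  then have "\<forall>\<^sub>F x in nhds w. ?p x < 0" using nb(1) by (auto simp: eventually_nhds)
  then have "germ_eq w ?f (mv_zero McNaughton)"
    unfolding germ_eq_def by (rule eventually_mono) (simp add: clip_def)
  moreover have "?f z \<noteq> 0" using nb(2) assms(2) by (simp add: clip_def)
  ultimately show ?thesis by blast
qed

lemma hopfian_germinal:
  fixes w :: "real^'n"
  assumes w: "w \<in> interior cube" and germinal: "germinal_ulgroup G w"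
  shows "hopfian G"
proof -
  have G: "unital_lgroup G" using germinal by (simp add: germinal_ulgroup_def)
  obtain \<gamma> where \<gamma>_closed: "\<And>f. mcnaughton_function f \<Longrightarrow> \<gamma> f \<in> carrier (Gamma G)"
    and \<gamma>_onto: "\<And>z. z \<in> carrier (Gamma G) \<Longrightarrow> \<exists>f. mcnaughton_function f \<and> \<gamma> f = z"
    and \<gamma>_eq: "\<And>f g. \<lbrakk>mcnaughton_function f; mcnaughton_function g\<rbrakk> \<Longrightarrow>
      \<gamma> f = \<gamma> g \<longleftrightarrow> germ_eq w f g"
    and \<gamma>_zero: "\<gamma> (mv_zero McNaughton) = mv_zero (Gamma G)"
    and \<gamma>_neg: "\<And>f. mcnaughton_function f \<Longrightarrow> \<gamma> (mv_neg McNaughton f) = mv_neg (Gamma G) (\<gamma> f)"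
    and \<gamma>_plus: "\<And>f g. \<lbrakk>mcnaughton_function f; mcnaughton_function g\<rbrakk> \<Longrightarrow>
      \<gamma> (mv_plus McNaughton f g) = mv_plus (Gamma G) (\<gamma> f) (\<gamma> g)"
    using germinal_presentation[OF germinal] by blast
  show ?thesis
  proof (rule hopfianI_Gamma[OF G])
    fix h z
    assume h: "h \<in> ul_hom G G" "h ` carrier G = carrier G"
      and z: "z \<in> carrier (Gamma G)" "h z = \<one>\<^bsub>G\<^esub>"
    note h_Gamma = ul_hom_Gamma[OF G h(1)]
    define \<pi> where "\<pi> i = restrict (\<lambda>x::real^'n. x $ i) cube" for i
    have \<pi>: "mcnaughton_function (\<pi> i)" for i
      unfolding \<pi>_def by (rule mcnaughton_coord)
    have "\<forall>i. \<exists>f. mcnaughton_function f \<and> \<gamma> f = h (\<gamma> (\<pi> i))"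
      \<comment> \<open>The chosen representatives \<open>c i\<close> are defined on the whole cube
        and become the components of \<open>g\<close>.\<close>
      using \<gamma>_onto h_Gamma(2) \<gamma>_closed[OF \<pi>] by blast
    then obtain c where c: "\<And>i. mcnaughton_function (c i)" "\<And>i. \<gamma> (c i) = h (\<gamma> (\<pi> i))"
      by metis
    define g where "g x = (\<chi> i. c i x)" for x
    have g_cube: "g x \<in> cube" if "x \<in> cube" for x
      using mcnaughton_range[OF c(1) that] by (simp add: g_def cube_def)
    have g_cont: "continuous_on cube g"
      unfolding g_def using c(1) by (intro continuous_on_vec_lambda) (simp add: mcnaughton_function_def)
    define C where "C f = restrict (f \<circ> g) cube" for f :: "real^'n \<Rightarrow> real"
    have C: "C f x = f (g x)" if "x \<in> cube" for f x using that by (simp add: C_def)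
    have zero_mc: "mcnaughton_function (mv_zero McNaughton :: real^'n \<Rightarrow> real)"
      using mcnaughton_zero by simp
    \<comment> \<open>Composition with \<open>g\<close> commutes with the pointwise operations
      because \<open>g\<close> maps the cube into itself, and on coordinates it agrees with
      \<open>h\<close> by the choice of \<open>c\<close>.\<close>
    have comp: "mcnaughton_function (C f) \<and> h (\<gamma> f) = \<gamma> (C f)"
      if "mcnaughton_function f" for f
      using coordinate_generated_McNaughton[OF that]
    proof (induction rule: coordinate_generated.induct)
      case (coord i)
      have eq: "C (\<pi> i) = c i"
        unfolding C_def using c(1)[of i] g_cube
        by (intro extensionalityI[of _ cube]) (auto simp: mcnaughton_function_def g_def \<pi>_def)
      show ?case unfolding \<pi>_def[symmetric] eq using c by simp
    next
      case zero
      have "C (mv_zero McNaughton) = mv_zero McNaughton"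
        unfolding C_def using g_cube by (auto intro!: restrict_ext)
      then show ?case using h_Gamma(1) \<gamma>_zero zero_mc by (simp del: McNaughton_simps)
    next
      case (neg f)
      have "C (mv_neg McNaughton f) = mv_neg McNaughton (C f)"
        unfolding C_def using g_cube by (auto intro!: restrict_ext)
      then show ?case
        using neg.IH h_Gamma(3) \<gamma>_neg \<gamma>_closed mcnaughton_coordinate_generated[OF neg.hyps]
          mv_algebra.neg_closed[OF mv_algebra_McNaughton, of "C f"]
        by (simp del: McNaughton_simps(2-))
    next
      case (plus f f')
      have "C (mv_plus McNaughton f f') =
        mv_plus McNaughton (C f) (C f')"
        unfolding C_def using g_cube by (auto intro!: restrict_ext)
      then show ?case
        using plus.IH h_Gamma(4) \<gamma>_plus \<gamma>_closed plus.hyps[THEN mcnaughton_coordinate_generated]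
          mv_algebra.plus_closed[OF mv_algebra_McNaughton,
            of "C f" "C f'"]
        by (simp del: McNaughton_simps(2-))
    qed
    have w_cube: "w \<in> cube" using w interior_subset by blast
    have vanish: "h (\<gamma> f) = mv_zero (Gamma G) \<longleftrightarrow> germ_eq w (C f) (mv_zero McNaughton)"
      if "mcnaughton_function f" for f
      using comp[OF that] \<gamma>_eq zero_mc by (simp del: McNaughton_simps flip: \<gamma>_zero)
    have "g w = w"
    proof (rule ccontr)
      assume "g w \<noteq> w"
      then obtain f where f: "mcnaughton_function f" "germ_eq w f (mv_zero McNaughton)" "f (g w) \<noteq> 0"
        using mcnaughton_vanishing_near[of w "g w"] g_cube[OF w_cube] by auto
      \<comment> \<open>As \<open>f\<close> has zero germ, so has \<open>C f\<close>; evaluating at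
        \<open>w\<close> itself gives \<open>f (g w) = 0\<close>.\<close>
      have "\<gamma> f = mv_zero (Gamma G)" using \<gamma>_eq[OF f(1) zero_mc] f(2) \<gamma>_zero by simp
      then have "germ_eq w (C f) (mv_zero McNaughton)"
        using vanish[OF f(1)] h_Gamma(1) by simp
      then have "C f w = 0"
        using eventually_nhds_x_imp_x[of _ w] w_cube by (fastforce simp: germ_eq_def)
      then show False using f(3) w_cube by (simp add: C)
    qed
    \<comment> \<open>A preimage under \<open>h\<close> of the coordinate germ
      \<open>\<pi> i\<close> is represented by a \<open>k\<close> that reads the \<open>i\<close>-th
      coordinate of \<open>x\<close> off \<open>g x\<close> near \<open>w\<close>. Together these
      are the components of a local left inverse of \<open>g\<close>.\<close>
    have "\<exists>k. germ_eq w (C k) (\<pi> i)" for i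
    proof -
      obtain v where v: "v \<in> carrier (Gamma G)" "h v = \<gamma> (\<pi> i)"
        using ul_hom_Gamma_onto[OF G h \<gamma>_closed[OF \<pi>]] by blast
      then obtain k where k: "mcnaughton_function k" "\<gamma> k = v" using \<gamma>_onto by blast
      then have "\<gamma> (C k) = \<gamma> (\<pi> i)" using comp[OF k(1)] v by simp
      then show ?thesis using \<gamma>_eq[OF _ \<pi>] comp[OF k(1)] by blast
    qed
    then obtain k where k: "\<And>i. germ_eq w (C (k i)) (\<pi> i)" by metis
    obtain f where f: "mcnaughton_function f" "\<gamma> f = z" using \<gamma>_onto z by blast
    then have "germ_eq w (C f) (mv_zero McNaughton)"
      using vanish[of f] z by (simp add: Gamma_def)
    moreover have "\<forall>\<^sub>F x in nhds w. \<forall>i. x \<in> cube \<longrightarrow> C (k i) x = \<pi> i x"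
      using k unfolding germ_eq_def by (rule eventually_all_finite)
    \<comment> \<open>Interiority of \<open>w\<close> provides a neighbourhood \<open>V\<close> that
      is open in the whole space and inside the cube, as invariance of domain requires.\<close>
    moreover have "\<forall>\<^sub>F x in nhds w. x \<in> interior cube"
      using w by (intro eventually_nhds_in_open) auto
    ultimately have "\<forall>\<^sub>F x in nhds w. x \<in> cube \<and> f (g x) = 0 \<and> (\<forall>i. k i (g x) = x $ i)"
      unfolding germ_eq_def
    proof eventually_elim
      case (elim x)
      then have "x \<in> cube" using interior_subset by blast
      then show ?case using elim by (simp add: \<pi>_def C)
    qed
    then obtain V where V: "open V" "w \<in> V" "\<And>x. x \<in> V \<Longrightarrow> x \<in> cube"
      "\<And>x. x \<in> V \<Longrightarrow> f (g x) = 0" "\<And>x i. x \<in> V \<Longrightarrow> k i (g x) = x $ i"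
      unfolding eventually_nhds by blast
    have "inj_on g V"
    proof (rule inj_onI)
      fix x y assume xy: "x \<in> V" "y \<in> V" "g x = g y"
      have "x $ i = y $ i" for i using V(5)[OF xy(1), of i] V(5)[OF xy(2), of i] xy(3) by simp
      then show "x = y" by (simp add: vec_eq_iff)
    qed
    moreover have "continuous_on V g" using g_cont V(3) by (meson continuous_on_subset subsetI)
    ultimately have "open (g ` V)" using V(1) by (intro invariance_of_domain)
    moreover have "w \<in> g ` V" using V(2) \<open>g w = w\<close> by force
    \<comment> \<open>The image of \<open>V\<close> is an open neighbourhood of \<open>w\<close>,
      because \<open>g\<close> fixes \<open>w\<close>, and \<open>f\<close> vanishes on it.\<close>
    ultimately have "germ_eq w f (mv_zero McNaughton)"
      unfolding germ_eq_def eventually_nhds using V(4) by (intro exI[of _ "g ` V"]) auto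
    then have "z = mv_zero (Gamma G)" using \<gamma>_eq[OF f(1) zero_mc] f(2) \<gamma>_zero by simp
    then show "z = \<one>\<^bsub>G\<^esub>" by (simp add: Gamma_def)
  qed
qed

theorem corollary4p2:
  shows "(\<forall>G :: 'a ulgroup. unital_lgroup G \<and> ul_simple G \<longrightarrow> hopfian G) \<and>
         (\<forall>G :: 'b ulgroup. unital_lgroup G \<and> ul_finitely_generated G \<and>
            finite {P. ul_prime_ideal G P} \<longrightarrow> hopfian G) \<and>
         (\<forall>(w :: real^'n) (G :: 'c ulgroup).
            rational_point w \<and> w \<in> interior cube \<and> germinal_ulgroup G w \<longrightarrow> hopfian G)"
  using hopfian_simple hopfian_finite_spectrum hopfian_germinal by blast

end
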